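(* There are infinitely many primitive (divergent) ribbon graphs with $\vec n=(4)$, i.e. infinitely many isomorphism classes of connected bridgeless ribbon graphs of genus $0$ with a single boundary, of length $4$, and all vertices of degree four, which are primitive.
   Context: A ribbon graph is a triple $G=(\mathcal{H},\sigma,\alpha)$ of a finite set $\mathcal{H}$ of half edges, a permutation $\sigma$ and an involution $\alpha$ of $\mathcal{H}$ (fixed points allowed). Cycles of $\sigma$ are vertices (degree = length), 2-cycles of $\alpha$ are internal edges, fixed points of $\alpha$ are external half edges. A cycle of $\sigma^{-1}\circ\alpha$ is an internal face if it contains no external half edge, otherwise a boundary, whose length is its number of external half edges. $G$ is connected if $\langle\sigma,\alpha\rangle$ is transitive; its genus $g$ is given by $2-2g=|\mathcal{C}(\sigma)|-|\{\text{internal edges}\}|+|\mathcal{C}(\sigma^{-1}\alpha)|$, with $\mathcal{C}(\cdot)$ the set of cycles. Bridgeless: cutting any one internal edge (replacing a 2-cycle of $\alpha$ by two fixed points) does not disconnect a component. Call divergent graphs the connected bridgeless ribbon graphs of genus $0$ with exactly one boundary, of length 2 or 4, and all vertices of degree 4 (the single vertex included). A ribbon subgraph $H\subset G=(\mathcal{H},\sigma,\alpha)$ is $(\mathcal{H},\sigma,\alpha')$ where the 2-cycles of $\alpha'$ are among those of $\alpha$. A divergent graph $G$ is primitive if it has no ribbon subgraph $H\subsetneq G$ that has at least one internal edge and all of whose connected components are divergent graphs. Isomorphisms are bijections of half edges intertwining $\sigma$ and $\alpha$. *)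

theory Defs
  imports "HOL-Algebra.Generated_Groups" "HOL-Combinatorics.Permutations"
    "HOL-Combinatorics.Orbits" "HOL-Library.Multiset"
begin

record 'h ribbon_graph =
  half_edges :: "'h set"
  vert_perm :: "'h \<Rightarrow> 'h"
  edge_inv :: "'h \<Rightarrow> 'h"

text \<open>
  As usual for \<^const>\<open>permutes\<close>, both permutations are the identity outside the set of half
  edges, so equality of records is equality of ribbon graphs.
\<close>

definition ribbon_graph :: "'h ribbon_graph \<Rightarrow> bool" where
  "ribbon_graph G \<longleftrightarrow>
     finite (half_edges G) \<and>
     vert_perm G permutes half_edges G \<and>
     edge_inv G permutes half_edges G \<and>
     edge_inv G \<circ> edge_inv G = id"

definition perm_cycles :: "('h \<Rightarrow> 'h) \<Rightarrow> 'h set \<Rightarrow> 'h set set" where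
  "perm_cycles p A = orbit p ` A"

definition vertices :: "'h ribbon_graph \<Rightarrow> 'h set set" where
  "vertices G = perm_cycles (vert_perm G) (half_edges G)"

definition internal_edges :: "'h ribbon_graph \<Rightarrow> 'h set set" where
  "internal_edges G = {e \<in> perm_cycles (edge_inv G) (half_edges G). card e = 2}"

definition external_half_edges :: "'h ribbon_graph \<Rightarrow> 'h set" where
  "external_half_edges G = {h \<in> half_edges G. edge_inv G h = h}"

definition face_perm :: "'h ribbon_graph \<Rightarrow> 'h \<Rightarrow> 'h" where
  "face_perm G = Hilbert_Choice.inv (vert_perm G) \<circ> edge_inv G"

definition faces :: "'h ribbon_graph \<Rightarrow> 'h set set" where
  "faces G = perm_cycles (face_perm G) (half_edges G)"

definition internal_faces :: "'h ribbon_graph \<Rightarrow> 'h set set" where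
  "internal_faces G = {f \<in> faces G. f \<inter> external_half_edges G = {}}"

definition boundaries :: "'h ribbon_graph \<Rightarrow> 'h set set" where
  "boundaries G = faces G - internal_faces G"

definition boundary_length :: "'h ribbon_graph \<Rightarrow> 'h set \<Rightarrow> nat" where
  "boundary_length G b = card (b \<inter> external_half_edges G)"

definition boundary_lengths :: "'h ribbon_graph \<Rightarrow> nat multiset" where
  "boundary_lengths G = image_mset (boundary_length G) (mset_set (boundaries G))"

definition permutation_group :: "'h set \<Rightarrow> ('h \<Rightarrow> 'h) monoid" where
  "permutation_group A = \<lparr>carrier = {p. p permutes A}, monoid.mult = (\<circ>), one = id\<rparr>"

lemma group_permutation_group: "group (permutation_group A)"
proof (rule groupI)
  fix p assume "p \<in> carrier (permutation_group A)"
  then have "p permutes A" by (simp add: permutation_group_def)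
  then show "\<exists>q\<in>carrier (permutation_group A).
      q \<otimes>\<^bsub>permutation_group A\<^esub> p = \<one>\<^bsub>permutation_group A\<^esub>"
    using permutes_inv permutes_inv_o(2) unfolding permutation_group_def by fastforce
qed (auto simp: permutation_group_def permutes_id permutes_compose o_assoc)

definition monodromy :: "'h ribbon_graph \<Rightarrow> ('h \<Rightarrow> 'h) set" where
  "monodromy G = generate (permutation_group (half_edges G)) {vert_perm G, edge_inv G}"

definition connected_graph :: "'h ribbon_graph \<Rightarrow> bool" where
  "connected_graph G \<longleftrightarrow>
     (\<forall>x\<in>half_edges G. \<forall>y\<in>half_edges G. \<exists>g\<in>monodromy G. g x = y)"

definition component_sets :: "'h ribbon_graph \<Rightarrow> 'h set set" where
  "component_sets G = (\<lambda>x. {g x | g. g \<in> monodromy G}) ` half_edges G"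

definition restrict_graph :: "'h ribbon_graph \<Rightarrow> 'h set \<Rightarrow> 'h ribbon_graph" where
  "restrict_graph G C =
     \<lparr>half_edges = C, vert_perm = perm_restrict (vert_perm G) C,
      edge_inv = perm_restrict (edge_inv G) C\<rparr>"

definition components :: "'h ribbon_graph \<Rightarrow> 'h ribbon_graph set" where
  "components G = restrict_graph G ` component_sets G"

definition has_genus :: "'h ribbon_graph \<Rightarrow> int \<Rightarrow> bool" where
  "has_genus G g \<longleftrightarrow>
     2 - 2 * g = int (card (vertices G)) - int (card (internal_edges G)) + int (card (faces G))"

definition cut_edge :: "'h ribbon_graph \<Rightarrow> 'h set \<Rightarrow> 'h ribbon_graph" where
  "cut_edge G e = G\<lparr>edge_inv := perm_restrict (edge_inv G) (- e)\<rparr>"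

text \<open>
  Cutting an edge can only refine the partition into components, so no component is disconnected
  iff this partition does not change.
\<close>

definition bridgeless :: "'h ribbon_graph \<Rightarrow> bool" where
  "bridgeless G \<longleftrightarrow>
     (\<forall>e\<in>internal_edges G. component_sets (cut_edge G e) = component_sets G)"

definition divergent :: "'h ribbon_graph \<Rightarrow> bool" where
  "divergent G \<longleftrightarrow>
     ribbon_graph G \<and> connected_graph G \<and> bridgeless G \<and> has_genus G 0 \<and>
     (boundary_lengths G = {#2#} \<or> boundary_lengths G = {#4#}) \<and>
     (\<forall>v\<in>vertices G. card v = 4)"

definition ribbon_subgraph :: "'h ribbon_graph \<Rightarrow> 'h ribbon_graph \<Rightarrow> bool" where
  "ribbon_subgraph H G \<longleftrightarrow>
     ribbon_graph H \<and> ribbon_graph G \<and>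
     half_edges H = half_edges G \<and> vert_perm H = vert_perm G \<and>
     internal_edges H \<subseteq> internal_edges G"

definition primitive :: "'h ribbon_graph \<Rightarrow> bool" where
  "primitive G \<longleftrightarrow>
     divergent G \<and>
     (\<nexists>H. ribbon_subgraph H G \<and> H \<noteq> G \<and> internal_edges H \<noteq> {} \<and>
          (\<forall>K\<in>components H. divergent K))"

definition isomorphic_graphs :: "'h ribbon_graph \<Rightarrow> 'k ribbon_graph \<Rightarrow> bool" where
  "isomorphic_graphs G G' \<longleftrightarrow>
     (\<exists>\<phi>. bij_betw \<phi> (half_edges G) (half_edges G') \<and>
          (\<forall>h\<in>half_edges G. \<phi> (vert_perm G h) = vert_perm G' (\<phi> h) \<and>
                            \<phi> (edge_inv G h) = edge_inv G' (\<phi> h)))"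

definition iso_rel :: "('h ribbon_graph \<times> 'h ribbon_graph) set" where
  "iso_rel = {(G, G'). ribbon_graph G \<and> ribbon_graph G' \<and> isomorphic_graphs G G'}"

lemma equiv_iso_rel: "equiv {G. ribbon_graph G} iso_rel"
proof (rule equivI)
  show "iso_rel \<subseteq> {G :: 'a ribbon_graph. ribbon_graph G} \<times> {G. ribbon_graph G}"
    by (auto simp: iso_rel_def)
  show "refl_on {G :: 'a ribbon_graph. ribbon_graph G} iso_rel"
    unfolding refl_on_def iso_rel_def isomorphic_graphs_def
    by (auto intro!: exI[of _ id])
  show "sym (iso_rel :: ('a ribbon_graph \<times> _) set)"
  proof (rule symI)
    fix G G' :: "'a ribbon_graph"
    assume "(G, G') \<in> iso_rel"
    then obtain \<phi> where rg: "ribbon_graph G" "ribbon_graph G'"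
      and b: "bij_betw \<phi> (half_edges G) (half_edges G')"
      and c: "\<And>h. h \<in> half_edges G \<Longrightarrow> \<phi> (vert_perm G h) = vert_perm G' (\<phi> h)"
             "\<And>h. h \<in> half_edges G \<Longrightarrow> \<phi> (edge_inv G h) = edge_inv G' (\<phi> h)"
      unfolding iso_rel_def isomorphic_graphs_def by blast
    let ?\<psi> = "inv_into (half_edges G) \<phi>"
    have cl: "vert_perm G h \<in> half_edges G" "edge_inv G h \<in> half_edges G"
      if "h \<in> half_edges G" for h
      using rg that by (auto simp: ribbon_graph_def permutes_in_image)
    have "?\<psi> (vert_perm G' k) = vert_perm G (?\<psi> k) \<and> ?\<psi> (edge_inv G' k) = edge_inv G (?\<psi> k)"
      if "k \<in> half_edges G'" for k
    proof -
      obtain h where h: "h \<in> half_edges G" "k = \<phi> h"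
        using b \<open>k \<in> half_edges G'\<close> by (auto simp: bij_betw_def)
      then show ?thesis
        using c[OF h(1)] cl[OF h(1)] b by (metis bij_betw_inv_into_left)
    qed
    then show "(G', G) \<in> iso_rel"
      using rg bij_betw_inv_into[OF b] unfolding iso_rel_def isomorphic_graphs_def by blast
  qed
  show "trans (iso_rel :: ('a ribbon_graph \<times> _) set)"
  proof (rule transI)
    fix G1 G2 G3 :: "'a ribbon_graph"
    assume "(G1, G2) \<in> iso_rel" "(G2, G3) \<in> iso_rel"
    then obtain \<phi> \<psi> where rg: "ribbon_graph G1" "ribbon_graph G3"
      and b: "bij_betw \<phi> (half_edges G1) (half_edges G2)"
             "bij_betw \<psi> (half_edges G2) (half_edges G3)"
      and c: "\<forall>h\<in>half_edges G1. \<phi> (vert_perm G1 h) = vert_perm G2 (\<phi> h) \<and>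
                                 \<phi> (edge_inv G1 h) = edge_inv G2 (\<phi> h)"
             "\<forall>h\<in>half_edges G2. \<psi> (vert_perm G2 h) = vert_perm G3 (\<psi> h) \<and>
                                 \<psi> (edge_inv G2 h) = edge_inv G3 (\<psi> h)"
      unfolding iso_rel_def isomorphic_graphs_def by blast
    have "\<phi> h \<in> half_edges G2" if "h \<in> half_edges G1" for h
      using b(1) that by (auto simp: bij_betw_def)
    then show "(G1, G3) \<in> iso_rel"
      using rg c bij_betw_trans[OF b] unfolding iso_rel_def isomorphic_graphs_def
      by (auto intro!: exI[of _ "\<psi> \<circ> \<phi>"])
  qed
qed

end

theory Submission
  imports Defs
begin

text \<open>
  The antiprism over a \<open>k\<close>-gon is a plane 4-regular graph: its vertices are the residues modulo
  \<open>2 * k\<close>, and \<open>i\<close> is joined to \<open>i \<plusminus> 1\<close> and \<open>i \<plusminus> 2\<close>. Removing the vertex 0 and keeping its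
  four edges as external half edges merges the four faces around 0 into one boundary of length 4.
  Any set of at least two but not all of the remaining vertices is left by at least five half
  edges (external ones included), whereas a divergent component of a subgraph has at most four
  external half edges. Hence a subgraph with an internal edge and divergent components has only
  one component, and counting external half edges again shows that it is the whole graph.
\<close>

section \<open>Orbits, edges and components\<close>

text \<open>The obstacle is the single vertex: it is itself divergent and has four external half
  edges, so a bound on edge cuts can exceed four only for two or more vertices. The second vertex
  comes from the internal edge that the subgraph must have, because the antiprism has no loops. The
  numbering runs in zigzag between the two k-gons and turns geometry into arithmetic: steps of 1 are
  the lateral edges, which form a Hamiltonian cycle, and steps of 2 are the sides of the k-gons. A
  cut can then be estimated at the smallest and largest vertex numbers of a set. Since
  \<open>n = 2 * k - 1\<close> is odd, the vertices 1 and \<open>n\<close> lie on the same k-gon,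
  the one that keeps all its vertices. Genus 0 is obtained by counting. Faces are not enumerated as
  cycles; an explicit label constant along \<open>face_perm\<close>, with one reachable
  representative per label, identifies them. Different \<open>n\<close> give different numbers
  \<open>4 * n\<close> of half edges, hence non-isomorphic graphs.\<close>

lemma permutes_self_in_orbit:
  assumes "p permutes A" "finite A"
  shows "x \<in> orbit p x"
proof (rule permutation_self_in_orbit)
  show "permutation p"
    unfolding permutation_permutes using assms by blast
qed

text \<open>The label is constant along a cycle by \<open>invar\<close>; by \<open>reach\<close>
  every element lies on the cycle of the representative \<open>r\<close> of its label, so equal
  labels mean equal cycles. Vertices (label \<open>h div 4\<close>) and faces (label
  \<open>face_label\<close>) are both determined this way.\<close>

lemma orbit_eq_label_class:
  assumes p: "p permutes A" "finite A"
    and invar: "\<And>x. x \<in> A \<Longrightarrow> L (p x) = L x"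
    and reach: "\<And>x. x \<in> A \<Longrightarrow> x \<in> orbit p (r (L x))"
    and x: "x \<in> A"
  shows "orbit p x = {y \<in> A. L y = L x}"
proof -
  have eq: "orbit p y = orbit p (r (L y))" if "y \<in> A" for y
    using orbit_cyclic_eq3[OF cyclic_on_orbit[OF p] reach[OF that]] .
  have self: "y \<in> orbit p y" for y
    by (rule permutes_self_in_orbit[OF p])
  have "L y = L x" if "y \<in> orbit p x" for y
    using that by induct (use invar x permutes_orbit_subset[OF p(1) x] in auto)
  moreover have "y \<in> orbit p x" if "y \<in> A" "L y = L x" for y
    using eq[OF x] eq[OF that(1)] self[of y] that(2) by simp
  ultimately show ?thesis
    using permutes_orbit_subset[OF p(1) x] by blast
qed

lemma perm_cycles_eq_label_classes:
  assumes p: "p permutes A" "finite A"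
    and invar: "\<And>x. x \<in> A \<Longrightarrow> L (p x) = L x"
    and reach: "\<And>x. x \<in> A \<Longrightarrow> x \<in> orbit p (r (L x))"
    and labels: "L ` A = I"
  shows "perm_cycles p A = (\<lambda>c. {y \<in> A. L y = c}) ` I"
    and "card (perm_cycles p A) = card I"
proof -
  show *: "perm_cycles p A = (\<lambda>c. {y \<in> A. L y = c}) ` I"
    unfolding perm_cycles_def labels[symmetric] image_image
    by (intro image_cong refl orbit_eq_label_class[OF p invar reach])
  have "inj_on (\<lambda>c. {y \<in> A. L y = c}) I"
    unfolding inj_on_def labels[symmetric] by blast
  then show "card (perm_cycles p A) = card I"
    unfolding * by (rule card_image)
qed

lemma orbit_involution:
  assumes "f \<circ> f = id"
  shows "orbit f x = {x, f x}"
proof -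
  have ff: "f (f y) = y" for y
    using assms by (metis comp_apply id_apply)
  have "y \<in> {x, f x}" if "y \<in> orbit f x" for y
    using that by induct (auto simp: ff)
  moreover have "f x \<in> orbit f x" "x \<in> orbit f x"
    using orbit.base[of f x] orbit.step[OF orbit.base[of f x]] by (simp_all add: ff)
  ultimately show ?thesis by auto
qed

lemma internal_edges_eq:
  assumes "ribbon_graph G"
  shows "internal_edges G = {{h, edge_inv G h} | h. h \<in> half_edges G \<and> edge_inv G h \<noteq> h}"
proof -
  have "orbit (edge_inv G) h = {h, edge_inv G h}" for h
    using assms by (simp add: orbit_involution ribbon_graph_def)
  then show ?thesis
    unfolding internal_edges_def perm_cycles_def by (auto simp: card_insert_if)
qed

text \<open>The internal edges partition the half edges that are not external into pairs. This
  supplies the edge count in the Euler formula.\<close>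

lemma card_internal_edges:
  assumes G: "ribbon_graph G"
  shows "2 * card (internal_edges G) + card (external_half_edges G) = card (half_edges G)"
proof -
  let ?E = "internal_edges G"
  have fin: "finite (half_edges G)" and inv: "edge_inv G (edge_inv G h) = h" for h
    using G by (auto simp: ribbon_graph_def fun_eq_iff)
  have cl: "edge_inv G h \<in> half_edges G" if "h \<in> half_edges G" for h
    using G that by (auto simp: ribbon_graph_def permutes_in_image)
  have U: "\<Union>?E = half_edges G - external_half_edges G"
    unfolding internal_edges_eq[OF G] external_half_edges_def by (auto simp: cl inv)
  have "?E \<subseteq> Pow (half_edges G)"
    using cl by (auto simp: internal_edges_eq[OF G])
  then have "finite ?E"
    using fin by (meson finite_Pow_iff finite_subset)
  then have "2 * card ?E = card (\<Union>?E)"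
  proof (rule card_partition)
    show "finite (\<Union>?E)" using fin by (simp add: U)
    show "card c = 2" if "c \<in> ?E" for c
      using that by (simp add: internal_edges_def)
    have eq: "c = {h, edge_inv G h}" if "c \<in> ?E" "h \<in> c" for c h
      using that inv unfolding internal_edges_eq[OF G] by auto
    show "c \<inter> d = {}" if "c \<in> ?E" "d \<in> ?E" "c \<noteq> d" for c d
      using that eq by blast
  qed
  moreover have "external_half_edges G \<subseteq> half_edges G"
    by (auto simp: external_half_edges_def)
  moreover from this have "finite (external_half_edges G)"
    using fin by (rule finite_subset)
  ultimately show ?thesis
    using fin card_mono[of "half_edges G" "external_half_edges G"]
    by (simp add: U card_Diff_subset)
qed

section \<open>Components as sets closed under both permutations\<close>

lemma monodromy_permutes:
  assumes "ribbon_graph G" "g \<in> monodromy G"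
  shows "g permutes half_edges G"
proof -
  have "monodromy G \<subseteq> carrier (permutation_group (half_edges G))"
    unfolding monodromy_def using assms(1)
    by (intro group.generate_incl group_permutation_group)
      (auto simp: permutation_group_def ribbon_graph_def)
  then show ?thesis
    using assms(2) by (auto simp: permutation_group_def)
qed

text \<open>Composing a generator with a monodromy element stays in the monodromy group. From here
  on components are handled through closure under the two permutations instead of through the
  group.\<close>

lemma component_closed:
  assumes G: "ribbon_graph G" and C: "C \<in> component_sets G"
  shows "C \<subseteq> half_edges G" "C \<noteq> {}"
    and "h \<in> C \<Longrightarrow> vert_perm G h \<in> C" "h \<in> C \<Longrightarrow> edge_inv G h \<in> C"
proof -
  let ?P = "permutation_group (half_edges G)"
  obtain x where x: "x \<in> half_edges G" and Cx: "C = {g x | g. g \<in> monodromy G}"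
    using C by (auto simp: component_sets_def)
  show "C \<subseteq> half_edges G"
    using x monodromy_permutes[OF G] by (auto simp: Cx permutes_in_image)
  have "\<one>\<^bsub>?P\<^esub> \<in> monodromy G" unfolding monodromy_def by (rule generate.one)
  then show "C \<noteq> {}" by (auto simp: Cx)
  have step: "p h \<in> C" if "h \<in> C" "p \<in> {vert_perm G, edge_inv G}" for p h
  proof -
    obtain g where g: "g \<in> monodromy G" "h = g x" using \<open>h \<in> C\<close>
      by (auto simp: Cx)
    have "p \<otimes>\<^bsub>?P\<^esub> g \<in> monodromy G"
      using g(1) that(2) unfolding monodromy_def by (auto intro: generate.eng generate.incl)
    then have "p \<circ> g \<in> monodromy G" by (simp add: permutation_group_def)
    moreover have "p h = (p \<circ> g) x" using g(2) by simp
    ultimately show ?thesis unfolding Cx by blast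
  qed
  show "h \<in> C \<Longrightarrow> vert_perm G h \<in> C" "h \<in> C \<Longrightarrow> edge_inv G h \<in> C"
    by (rule step; simp)+
qed

lemma component_containing:
  assumes "x \<in> half_edges G"
  obtains C where "C \<in> component_sets G" "x \<in> C"
proof
  show "{g x | g. g \<in> monodromy G} \<in> component_sets G"
    using assms by (auto simp: component_sets_def)
  have "\<one>\<^bsub>permutation_group (half_edges G)\<^esub> \<in> monodromy G"
    unfolding monodromy_def by (rule generate.one)
  then have "id \<in> monodromy G" by (simp add: permutation_group_def)
  then show "x \<in> {g x | g. g \<in> monodromy G}"
    by (metis (mono_tags, lifting) id_apply mem_Collect_eq)
qed

text \<open>Every component satisfies the premises of \<open>closed\<close>, so it must be
  everything. Connectedness and bridgelessness are both derived from this criterion.\<close>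

lemma one_component:
  assumes G: "ribbon_graph G" and ne: "half_edges G \<noteq> {}"
    and closed: "\<And>S. \<lbrakk>S \<subseteq> half_edges G; S \<noteq> {}; \<And>h. h \<in> S \<Longrightarrow> vert_perm G h \<in> S;
                 \<And>h. h \<in> S \<Longrightarrow> edge_inv G h \<in> S\<rbrakk> \<Longrightarrow> S = half_edges G"
  shows "component_sets G = {half_edges G}"
proof -
  have "C = half_edges G" if "C \<in> component_sets G" for C
    using component_closed[OF G that] closed by blast
  moreover have "component_sets G \<noteq> {}" using ne by (simp add: component_sets_def)
  ultimately show ?thesis by blast
qed

lemma connected_graph_if_one_component:
  assumes "component_sets G = {half_edges G}"
  shows "connected_graph G"
  unfolding connected_graph_def
proof (intro ballI)
  fix x y assume x: "x \<in> half_edges G" and y: "y \<in> half_edges G"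
  have "{g x | g. g \<in> monodromy G} \<in> component_sets G"
    using x by (auto simp: component_sets_def)
  then have "{g x | g. g \<in> monodromy G} = half_edges G" using assms by simp
  then have "y \<in> {g x | g. g \<in> monodromy G}" using y by simp
  then show "\<exists>g\<in>monodromy G. g x = y" by blast
qed

text \<open>An edge is a whole cycle of \<open>edge_inv\<close>, so making its half edges fixed
  points leaves an involution, which is its own inverse and hence a permutation.\<close>

lemma ribbon_graph_cut_edge:
  assumes G: "ribbon_graph G" and e: "e \<in> internal_edges G"
  shows "ribbon_graph (cut_edge G e)"
proof -
  let ?f = "perm_restrict (edge_inv G) (- e)"
  have inv: "edge_inv G (edge_inv G h) = h" for h
    using G by (auto simp: ribbon_graph_def fun_eq_iff)
  have p: "edge_inv G permutes half_edges G" using G by (simp add: ribbon_graph_def)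
  have "edge_inv G h \<in> e \<longleftrightarrow> h \<in> e" for h
    using e inv unfolding internal_edges_eq[OF G] by (auto; metis)
  then have ff: "?f (?f h) = h" for h
    by (simp add: perm_restrict_def inv)
  then have "bij_betw ?f (half_edges G) (half_edges G)"
    using permutes_in_image[OF p] by (intro bij_betwI[where g = ?f]) (auto simp: perm_restrict_def)
  moreover have "?f x = x" if "x \<notin> half_edges G" for x
    using p that by (simp add: perm_restrict_def permutes_not_in)
  ultimately have "?f permutes half_edges G" by (rule bij_imp_permutes)
  then show ?thesis
    using G ff by (simp add: ribbon_graph_def cut_edge_def fun_eq_iff)
qed

text \<open>Each external half edge lies on its own \<open>face_perm\<close> cycle, which is
  therefore a boundary. As there is only one boundary, it contains all of them, and its length 2 or
  4 is their total number.\<close>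

lemma divergent_card_external:
  assumes "divergent K"
  shows "card (external_half_edges K) \<le> 4"
proof -
  obtain k where k: "boundary_lengths K = {#k#}" "k \<le> 4"
    using assms by (auto simp: divergent_def)
  have "size (boundary_lengths K) = card (boundaries K)"
    by (simp add: boundary_lengths_def)
  then obtain b where b: "boundaries K = {b}"
    using k(1) by (metis card_1_singletonE size_single)
  then have "card (b \<inter> external_half_edges K) = k"
    using k(1) by (simp add: boundary_lengths_def boundary_length_def)
  moreover have "external_half_edges K \<subseteq> b"
  proof
    fix h assume h: "h \<in> external_half_edges K"
    have "finite (half_edges K)" "face_perm K permutes half_edges K"
      using assms
      by (auto simp: divergent_def ribbon_graph_def face_perm_def intro: permutes_compose permutes_inv)
    then have *: "h \<in> orbit (face_perm K) h"
      by (blast intro: permutes_self_in_orbit)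
    then have "orbit (face_perm K) h \<in> boundaries K"
      using h by (auto simp: boundaries_def internal_faces_def faces_def perm_cycles_def
          external_half_edges_def)
    then show "h \<in> b" using * b by auto
  qed
  ultimately show ?thesis
    using k(2) by (simp add: Int_absorb1)
qed

text \<open>Subgraphs are defined by inclusion of edge sets; this is the pointwise form: a half edge
  is either cut or keeps its partner.\<close>

lemma ribbon_subgraph_edge_inv:
  assumes "ribbon_subgraph H G" "edge_inv H h \<noteq> h"
  shows "edge_inv H h = edge_inv G h"
proof -
  have H: "ribbon_graph H" and G: "ribbon_graph G" and sub: "internal_edges H \<subseteq> internal_edges G"
    using assms(1) by (auto simp: ribbon_subgraph_def)
  have "h \<in> half_edges H"
    using H assms(2) by (auto simp: ribbon_graph_def permutes_def)
  then have "{h, edge_inv H h} \<in> internal_edges G"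
    using sub assms(2) unfolding internal_edges_eq[OF H] by blast
  moreover have "edge_inv G (edge_inv G y) = y" for y
    using G by (auto simp: ribbon_graph_def fun_eq_iff)
  ultimately show ?thesis
    unfolding internal_edges_eq[OF G] by (auto simp: doubleton_eq_iff)
qed

section \<open>Punctured antiprisms\<close>

text \<open>
  With \<open>n = 2 * k - 1\<close>, the remaining vertices are \<open>1, \<dots>, n\<close>. The half edges at vertex \<open>i\<close> are
  \<open>4 * i + d\<close>, where \<open>d = 0, 1, 2, 3\<close> points to the vertex \<open>i - 2\<close>, \<open>i - 1\<close>, \<open>i + 1\<close>, \<open>i + 2\<close>
  respectively. This is the cyclic order around even vertices; around odd ones it is reversed,
  since they lie on the other of the two \<open>k\<close>-gons.
\<close>

definition rot :: "nat \<Rightarrow> nat \<Rightarrow> nat \<Rightarrow> nat" where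
  "rot n c h = (if h \<in> {4..<4 * n + 4}
     then 4 * (h div 4) + (h mod 4 + (if even (h div 4) then c else 4 - c)) mod 4 else h)"

text \<open>Seen from its other end an edge points the opposite way, so offset \<open>d\<close> is
  paired with offset \<open>3 - d\<close>. The four fixed cases are the half edges towards the
  removed vertex 0. The pair \<open>4\<close>, \<open>4 * n + 3\<close> is the edge between the
  vertices 1 and \<open>n\<close>, which differ by 2 modulo \<open>n + 1 = 2 * k\<close>.\<close>

definition link :: "nat \<Rightarrow> nat \<Rightarrow> nat" where
  "link n h = (let i = h div 4; d = h mod 4 in
     if h \<notin> {4..<4 * n + 4} then h
     else if d = 0 then if i = 1 then 4 * n + 3 else if i = 2 then h else 4 * (i - 2) + 3
     else if d = 1 then if i = 1 then h else 4 * (i - 1) + 2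
     else if d = 2 then if i = n then h else 4 * (i + 1) + 1
     else if i = n then 4 else if i = n - 1 then h else 4 * (i + 2))"

definition punctured_antiprism :: "nat \<Rightarrow> nat ribbon_graph" where
  "punctured_antiprism n = \<lparr>half_edges = {4..<4 * n + 4}, vert_perm = rot n 1, edge_inv = link n\<rparr>"

lemma half_edge_cases:
  fixes h :: nat
  assumes "h \<in> {4..<4 * n + 4}"
  obtains i d where "h = 4 * i + d" "1 \<le> i" "i \<le> n" "d < 4"
proof
  show "h = 4 * (h div 4) + h mod 4" by simp
qed (use assms in auto)

lemma rot_eq:
  assumes "1 \<le> i" "i \<le> n" "d < 4"
  shows "rot n c (4 * i + d) = 4 * i + (d + (if even i then c else 4 - c)) mod 4"
  using assms by (simp add: rot_def)

text \<open>\<open>rot n c\<close> makes \<open>c\<close> quarter turns, in a sense given by the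
  parity of the vertex; \<open>4 - c\<close> more complete a full turn. The case
  \<open>c = 1\<close> gives the inverse \<open>rot n 3\<close> needed for
  \<open>face_perm\<close>.\<close>

lemma rot_inverse:
  assumes "c \<le> 4"
  shows "rot n (4 - c) (rot n c h) = h"
proof (cases "h \<in> {4..<4 * n + 4}")
  case True
  then obtain i d where h: "h = 4 * i + d" "1 \<le> i" "i \<le> n" "d < 4" by (rule half_edge_cases)
  define e where "e = (d + (if even i then c else 4 - c)) mod 4"
  have "rot n (4 - c) (rot n c h) = 4 * i + (e + (if even i then 4 - c else 4 - (4 - c))) mod 4"
    using h by (simp add: rot_eq e_def)
  also have "(e + (if even i then 4 - c else 4 - (4 - c))) mod 4 = d"
    using assms h by (auto simp: e_def mod_simps)
  finally show ?thesis by (simp add: h)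
next
  case False
  then have "rot n e h = h" for e by (auto simp: rot_def)
  then show ?thesis by simp
qed

lemma rot_permutes:
  assumes "c \<le> 4"
  shows "rot n c permutes {4..<4 * n + 4}"
proof (rule bij_imp_permutes)
  have cl: "rot n e h \<in> {4..<4 * n + 4}" if h: "h \<in> {4..<4 * n + 4}" for e h
  proof -
    obtain i d where "h = 4 * i + d" "1 \<le> i" "i \<le> n" "d < 4" using h
      by (rule half_edge_cases)
    moreover have "x mod 4 < 4" for x :: nat by simp
    ultimately show ?thesis by (simp add: rot_eq add_less_le_mono)
  qed
  show "bij_betw (rot n c) {4..<4 * n + 4} {4..<4 * n + 4}"
    using rot_inverse[OF assms] rot_inverse[of "4 - c"] assms cl
    by (intro bij_betwI[where g = "rot n (4 - c)"]) (auto simp: Pi_iff)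
qed (auto simp: rot_def)

lemma inv_rot: "Hilbert_Choice.inv (rot n 1) = rot n 3"
  using rot_inverse[of 1 n] rot_inverse[of 3 n] by (intro inv_equality) simp_all

lemma link_eq:
  assumes "1 \<le> i" "i \<le> n"
  shows "link n (4 * i) = (if i = 1 then 4 * n + 3 else if i = 2 then 8 else 4 * (i - 2) + 3)"
    and "link n (4 * i + 1) = (if i = 1 then 5 else 4 * (i - 1) + 2)"
    and "link n (4 * i + 2) = (if i = n then 4 * n + 2 else 4 * (i + 1) + 1)"
    and "link n (4 * i + 3) = (if i = n then 4 else if i = n - 1 then 4 * i + 3 else 4 * (i + 2))"
proof -
  have "4 * i + d \<in> {4..<4 * n + 4}" "(4 * i + d) div 4 = i" "(4 * i + d) mod 4 = d"
    if "d < 4" for d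
    using assms that by simp_all
  note * = this[of 0, simplified] this[of 1, simplified] this[of 2, simplified] this[of 3, simplified]
  show "link n (4 * i) = (if i = 1 then 4 * n + 3 else if i = 2 then 8 else 4 * (i - 2) + 3)"
    by (simp add: link_def * del: One_nat_def)
  show "link n (4 * i + 1) = (if i = 1 then 5 else 4 * (i - 1) + 2)"
    by (simp add: link_def * del: One_nat_def)
  show "link n (4 * i + 2) = (if i = n then 4 * n + 2 else 4 * (i + 1) + 1)"
    by (simp add: link_def * del: One_nat_def)
  show "link n (4 * i + 3) = (if i = n then 4 else if i = n - 1 then 4 * i + 3 else 4 * (i + 2))"
    by (simp add: link_def * del: One_nat_def)
qed

lemma half_edge_cases4:
  fixes h :: nat
  assumes "h \<in> {4..<4 * n + 4}"
  obtains i where "1 \<le> i" "i \<le> n" "h = 4 * i"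
    | i where "1 \<le> i" "i \<le> n" "h = 4 * i + 1"
    | i where "1 \<le> i" "i \<le> n" "h = 4 * i + 2"
    | i where "1 \<le> i" "i \<le> n" "h = 4 * i + 3"
proof -
  obtain i d where "h = 4 * i + d" "1 \<le> i" "i \<le> n" "d < 4"
    using assms by (rule half_edge_cases)
  moreover from this have "d = 0 \<or> d = 1 \<or> d = 2 \<or> d = 3" by auto
  ultimately show ?thesis using that by fastforce
qed

lemma link_link:
  assumes "4 \<le> n"
  shows "link n (link n h) = h"
proof (cases "h \<in> {4..<4 * n + 4}")
  case True
  have *: "link n 4 = 4 * n + 3" "link n 5 = 5" "link n 8 = 8"
    using link_eq(1)[of 1 n] link_eq(2)[of 1 n] link_eq(1)[of 2 n] assms by simp_all
  have step: "link n (4 * i + 3) = 4 * (i + 2)" if "1 \<le> i" "i + 2 \<le> n" for i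
    using link_eq(4)[of i n] that by auto
  from True show ?thesis
  proof (cases rule: half_edge_cases4)
    case (1 i)
    then consider "i = 1" | "i = 2" | "3 \<le> i" by linarith
    then show ?thesis
    proof cases
      case 1
      then show ?thesis using \<open>h = 4 * i\<close> assms * link_eq(4)[of n n] by simp
    next
      case 2
      then show ?thesis using \<open>h = 4 * i\<close> * by simp
    next
      case 3
      then show ?thesis
        using \<open>h = 4 * i\<close> \<open>i \<le> n\<close> link_eq(1)[of i n] step[of "i - 2"] by simp
    qed
  next
    case (2 i)
    then show ?thesis
      using assms * link_eq[of i n] link_eq(3)[of "i - 1" n] by (cases "i = 1") auto
  next
    case (3 i)
    then show ?thesis
      using assms link_eq[of i n] link_eq(2)[of "i + 1" n] by (cases "i = n") auto
  next
    case (4 i)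
    then show ?thesis
      using assms * link_eq[of i n] link_eq(1)[of "i + 2" n] by (cases "i + 2 \<le> n") auto
  qed
next
  case False
  then have "link n h = h" by (simp add: link_def)
  then show ?thesis by simp
qed

lemma link_in:
  assumes "4 \<le> n" "h \<in> {4..<4 * n + 4}"
  shows "link n h \<in> {4..<4 * n + 4}"
  using assms(2)
proof (cases rule: half_edge_cases4)
  case (1 i)
  then show ?thesis using assms link_eq(1)[of i n] by auto
next
  case (2 i)
  then show ?thesis using assms link_eq(2)[of i n] by auto
next
  case (3 i)
  then show ?thesis using assms link_eq(3)[of i n] by auto
next
  case (4 i)
  then show ?thesis using assms link_eq(4)[of i n] by auto
qed

lemma ribbon_graph_punctured_antiprism:
  assumes "4 \<le> n"
  shows "ribbon_graph (punctured_antiprism n)"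
proof -
  have "bij_betw (link n) {4..<4 * n + 4} {4..<4 * n + 4}"
    using link_in[OF assms] link_link[OF assms] by (intro bij_betwI[where g = "link n"]) auto
  then have "link n permutes {4..<4 * n + 4}"
    by (rule bij_imp_permutes) (auto simp: link_def)
  then show ?thesis
    using rot_permutes[of 1 n] link_link[OF assms]
    by (simp add: ribbon_graph_def punctured_antiprism_def fun_eq_iff)
qed

section \<open>External half edges\<close>

lemma link_fixed:
  assumes "4 \<le> n" "1 \<le> i" "i \<le> n"
  shows "link n (4 * i) = 4 * i \<longleftrightarrow> i = 2"
    and "link n (4 * i + 1) = 4 * i + 1 \<longleftrightarrow> i = 1"
    and "link n (4 * i + 2) = 4 * i + 2 \<longleftrightarrow> i = n"
    and "link n (4 * i + 3) = 4 * i + 3 \<longleftrightarrow> i = n - 1"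
proof -
  show "link n (4 * i) = 4 * i \<longleftrightarrow> i = 2"
    unfolding link_eq(1)[OF assms(2,3)] using assms by presburger
  show "link n (4 * i + 1) = 4 * i + 1 \<longleftrightarrow> i = 1"
    unfolding link_eq(2)[OF assms(2,3)] using assms by presburger
  show "link n (4 * i + 2) = 4 * i + 2 \<longleftrightarrow> i = n"
    unfolding link_eq(3)[OF assms(2,3)] using assms by presburger
  show "link n (4 * i + 3) = 4 * i + 3 \<longleftrightarrow> i = n - 1"
    unfolding link_eq(4)[OF assms(2,3)] using assms by presburger
qed

text \<open>The neighbours of the removed vertex are 1, 2, \<open>n - 1\<close> and
  \<open>n\<close>; their half edges towards it are \<open>4 * 1 + 1\<close>, \<open>4 * 2\<close>,
  \<open>4 * (n - 1) + 3\<close> and \<open>4 * n + 2\<close>.\<close>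

lemma external_punctured_antiprism:
  assumes "4 \<le> n"
  shows "external_half_edges (punctured_antiprism n) = {5, 8, 4 * n - 1, 4 * n + 2}"
proof -
  have *: "h \<in> {5, 8, 4 * n - 1, 4 * n + 2}" if h: "h \<in> {4..<4 * n + 4}" "link n h = h" for h
    using h(1)
  proof (cases rule: half_edge_cases4)
    case (1 i)
    then show ?thesis using h(2) link_fixed(1)[OF assms 1(1,2)] by simp
  next
    case (2 i)
    then show ?thesis using h(2) link_fixed(2)[OF assms 2(1,2)] by simp
  next
    case (3 i)
    then show ?thesis using h(2) link_fixed(3)[OF assms 3(1,2)] by simp
  next
    case (4 i)
    then have "i = n - 1" using h(2) link_fixed(4)[OF assms 4(1,2)] by simp
    then have "h = 4 * n - 1" using 4 assms by presburger
    then show ?thesis by simp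
  qed
  have n: "4 * n - 1 = 4 * (n - 1) + 3" using assms by presburger
  then have "link n (4 * n - 1) = 4 * n - 1"
    using link_fixed(4)[of n "n - 1"] assms by simp
  moreover have "link n 5 = 5" "link n 8 = 8" "link n (4 * n + 2) = 4 * n + 2"
    using link_eq(2)[of 1 n] link_eq(1)[of 2 n] link_eq(3)[of n n] assms by simp_all
  moreover have "{5, 8, 4 * n - 1, 4 * n + 2} \<subseteq> {4..<4 * n + 4}" using assms by auto
  ultimately show ?thesis
    using * by (auto simp: external_half_edges_def punctured_antiprism_def)
qed

lemma card_external_punctured_antiprism:
  assumes "4 \<le> n"
  shows "card (external_half_edges (punctured_antiprism n)) = 4"
proof -
  have "card {5, 8, a, b} = 4" if "5 \<noteq> a" "8 \<noteq> a" "5 \<noteq> b" "8 \<noteq> b" "a \<noteq> b" for a b :: nat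
    using that by simp
  moreover have "5 \<noteq> 4 * n - 1" "8 \<noteq> 4 * n - 1" "5 \<noteq> 4 * n + 2" "8 \<noteq> 4 * n + 2"
    "4 * n - 1 \<noteq> 4 * n + 2"
    using assms by presburger+
  ultimately show ?thesis unfolding external_punctured_antiprism[OF assms] by blast
qed

section \<open>Vertices\<close>

lemma rot_reach:
  assumes "h \<in> {4..<4 * n + 4}"
  shows "h \<in> orbit (rot n 1) (4 * (h div 4))"
proof -
  obtain i d where h: "h = 4 * i + d" "1 \<le> i" "i \<le> n" "d < 4"
    using assms by (rule half_edge_cases)
  have p: "rot n 1 permutes {4..<4 * n + 4}" by (rule rot_permutes) simp
  define x where "x = 4 * i"
  have 0: "4 * i \<in> orbit (rot n 1) x"
    unfolding x_def by (rule permutes_self_in_orbit[OF p]) simp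
  have s: "f \<in> orbit (rot n 1) x" if "e \<in> orbit (rot n 1) x" "rot n 1 e = f" for e f
    using orbit.step[OF that(1)] that(2) by simp
  have "4 * i + 1 \<in> orbit (rot n 1) x \<and> 4 * i + 2 \<in> orbit (rot n 1) x \<and>
    4 * i + 3 \<in> orbit (rot n 1) x"
  proof (cases "even i")
    case True
    then have "rot n 1 (4 * i) = 4 * i + 1" "rot n 1 (4 * i + 1) = 4 * i + 2"
      "rot n 1 (4 * i + 2) = 4 * i + 3"
      using h(2,3) rot_eq[of i n 0 1] rot_eq[of i n 1 1] rot_eq[of i n 2 1] rot_eq[of i n 3 1]
      by (simp_all del: One_nat_def add_2_eq_Suc add_2_eq_Suc')
    then show ?thesis using 0 s by blast
  next
    case False
    then have "rot n 1 (4 * i) = 4 * i + 3" "rot n 1 (4 * i + 3) = 4 * i + 2"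
      "rot n 1 (4 * i + 2) = 4 * i + 1"
      using h(2,3) rot_eq[of i n 0 1] rot_eq[of i n 1 1] rot_eq[of i n 2 1] rot_eq[of i n 3 1]
      by (simp_all del: One_nat_def add_2_eq_Suc add_2_eq_Suc')
    then show ?thesis using 0 s by blast
  qed
  moreover have "d = 0 \<or> d = 1 \<or> d = 2 \<or> d = 3" using h(4) by auto
  ultimately have "4 * i + d \<in> orbit (rot n 1) x" using 0 by auto
  then show ?thesis using h x_def by simp
qed

lemma rot_div:
  assumes "h \<in> {4..<4 * n + 4}"
  shows "rot n 1 h div 4 = h div 4"
  using assms by (simp add: rot_def)

lemma vertices_punctured_antiprism:
  assumes "4 \<le> n"
  shows "card (vertices (punctured_antiprism n)) = n"
    and "v \<in> vertices (punctured_antiprism n) \<Longrightarrow> card v = 4"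
proof -
  let ?A = "{4..<4 * n + 4}"
  have p: "rot n 1 permutes ?A" by (rule rot_permutes) simp
  have labels: "(\<lambda>h. h div 4) ` ?A = {1..n}"
  proof (intro equalityI subsetI)
    fix i assume "i \<in> {1..n}"
    then have "4 * i \<in> ?A" "i = (4 * i) div 4" by auto
    then show "i \<in> (\<lambda>h. h div 4) ` ?A" by blast
  qed auto
  note * = perm_cycles_eq_label_classes[where r = "\<lambda>c. 4 * c", OF p _ rot_div rot_reach labels, simplified]
  show "card (vertices (punctured_antiprism n)) = n"
    unfolding vertices_def punctured_antiprism_def using *(2) by simp
  assume "v \<in> vertices (punctured_antiprism n)"
  then obtain i where i: "i \<in> {1..n}" "v = {y. 4 \<le> y \<and> y < 4 * n + 4 \<and> y div 4 = i}"
    unfolding vertices_def punctured_antiprism_def using *(1) by auto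
  then have "v = {4 * i..<4 * i + 4}" by auto
  then show "card v = 4" by simp
qed

section \<open>Faces and genus\<close>

text \<open>Keeps half edges in the form \<open>4 * i + d\<close>.\<close>

declare One_nat_def [simp del] add_2_eq_Suc' [simp del]

lemma face_perm_punctured_antiprism:
  "face_perm (punctured_antiprism n) = rot n 3 \<circ> link n"
  by (simp add: face_perm_def punctured_antiprism_def inv_rot del: One_nat_def)

lemma rot_3_eq:
  assumes "1 \<le> i" "i \<le> n"
  shows "rot n 3 (4 * i) = (if even i then 4 * i + 3 else 4 * i + 1)"
    and "rot n 3 (4 * i + 1) = (if even i then 4 * i else 4 * i + 2)"
    and "rot n 3 (4 * i + 2) = (if even i then 4 * i + 1 else 4 * i + 3)"
    and "rot n 3 (4 * i + 3) = (if even i then 4 * i + 2 else 4 * i)"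
  using rot_eq[OF assms, of 0 3] rot_eq[OF assms, of 1 3] rot_eq[OF assms, of 2 3]
    rot_eq[OF assms, of 3 3]
  by (simp_all del: One_nat_def add_2_eq_Suc')

text \<open>The two exceptional values come from the external half edges \<open>8\<close> and
  \<open>4 * (n - 1) + 3\<close>: \<open>link\<close> fixes them, so the face continues at the same
  vertex, to \<open>11 = 4 * 2 + 3\<close> and to \<open>4 * i + 2\<close> with
  \<open>i = n - 1\<close>.\<close>

lemma face_perm_even:
  assumes n: "odd n" "7 \<le> n" and i: "even i" "2 \<le> i" "i \<le> n"
  defines "\<phi> \<equiv> face_perm (punctured_antiprism n)"
  shows "\<phi> (4 * i) = (if i = 2 then 11 else 4 * (i - 2) + 2)"
    and "\<phi> (4 * i + 1) = 4 * (i - 1) + 3"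
    and "\<phi> (4 * i + 2) = 4 * (i + 1) + 2"
    and "\<phi> (4 * i + 3) = (if i + 2 \<le> n then 4 * (i + 2) + 3 else 4 * i + 2)"
proof -
  note defs = \<phi>_def face_perm_punctured_antiprism comp_apply
  have "i \<noteq> 1" "i \<noteq> n" using n i by auto
  have i1: "1 \<le> i" using i by simp
  show "\<phi> (4 * i) = (if i = 2 then 11 else 4 * (i - 2) + 2)"
  proof (cases "i = 2")
    case True
    then show ?thesis
      using rot_3_eq(1)[of 2 n] link_eq(1)[OF i1 i(3)] n by (simp add: defs)
  next
    case False
    with i have "3 \<le> i" by simp
    then show ?thesis
      using rot_3_eq(4)[of "i - 2" n] link_eq(1)[OF i1 i(3)] i False \<open>i \<noteq> 1\<close>
        by (simp add: defs)
  qed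
  have "1 \<le> i - 1" "i - 1 \<le> n" "odd (i - 1)" using i by auto
  then show "\<phi> (4 * i + 1) = 4 * (i - 1) + 3"
    using rot_3_eq(3)[of "i - 1" n] link_eq(2)[OF i1 i(3)] \<open>i \<noteq> 1\<close>
    by (simp add: defs del: One_nat_def)
  have "1 \<le> i + 1" "i + 1 \<le> n" "odd (i + 1)" using i \<open>i \<noteq> n\<close> by auto
  then show "\<phi> (4 * i + 2) = 4 * (i + 1) + 2"
    using rot_3_eq(2)[of "i + 1" n] link_eq(3)[OF i1 i(3)] \<open>i \<noteq> n\<close>
    by (simp only: defs if_False simp_thms)
  show "\<phi> (4 * i + 3) = (if i + 2 \<le> n then 4 * (i + 2) + 3 else 4 * i + 2)"
  proof (cases "i + 2 \<le> n")
    case True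
    then have "i \<noteq> n - 1" "1 \<le> i + 2" "even (i + 2)" using i by auto
    then show ?thesis
      using True rot_3_eq(1)[of "i + 2" n] link_eq(4)[OF i1 i(3)] \<open>i \<noteq> n\<close>
      by (simp only: defs if_False if_True simp_thms)
  next
    case False
    then have "i = n - 1" using i \<open>i \<noteq> n\<close> by linarith
    then show ?thesis
      using False rot_3_eq(4)[OF i1 i(3)] link_eq(4)[OF i1 i(3)] i \<open>i \<noteq> n\<close>
      by (simp only: defs if_False if_True simp_thms)
  qed
qed

text \<open>The values \<open>6\<close> and \<open>4 * n + 3\<close> come from the external half
  edges \<open>5\<close> and \<open>4 * n + 2\<close>; the values \<open>4 * n\<close> and
  \<open>5\<close> come from the edge between the vertices 1 and \<open>n\<close>.\<close>

lemma face_perm_odd: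
  assumes n: "odd n" "7 \<le> n" and i: "odd i" "i \<le> n"
  defines "\<phi> \<equiv> face_perm (punctured_antiprism n)"
  shows "\<phi> (4 * i) = (if i = 1 then 4 * n else 4 * (i - 2))"
    and "\<phi> (4 * i + 1) = (if i = 1 then 6 else 4 * (i - 1) + 1)"
    and "\<phi> (4 * i + 2) = (if i = n then 4 * n + 3 else 4 * (i + 1))"
    and "\<phi> (4 * i + 3) = (if i = n then 5 else 4 * (i + 2) + 1)"
proof -
  note defs = \<phi>_def face_perm_punctured_antiprism comp_apply
  have i2: "i \<noteq> 2" using i by auto
  have i1: "1 \<le> i" using i by (cases i) auto
  have n1: "1 \<le> n" using n by simp
  have in1: "i \<noteq> n - 1" using i n by (cases n) auto
  show "\<phi> (4 * i) = (if i = 1 then 4 * n else 4 * (i - 2))"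
  proof (cases "i = 1")
    case True
    then show ?thesis
      using rot_3_eq(4)[OF n1 order.refl] link_eq(1)[OF i1 i(2)] n(1)
      by (simp only: defs if_False if_True simp_thms)
  next
    case False
    then have "1 \<le> i - 2" "i - 2 \<le> n" "odd (i - 2)" using i i1 i2 by auto
    then show ?thesis
      using False i2 rot_3_eq(4)[of "i - 2" n] link_eq(1)[OF i1 i(2)]
      by (simp only: defs if_False if_True simp_thms)
  qed
  show "\<phi> (4 * i + 1) = (if i = 1 then 6 else 4 * (i - 1) + 1)"
  proof (cases "i = 1")
    case True
    then show ?thesis
      using rot_3_eq(2)[of 1 n] link_eq(2)[OF i1 i(2)] n1 by (simp add: defs)
  next
    case False
    then have "1 \<le> i - 1" "i - 1 \<le> n" "even (i - 1)" using i i1 by auto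
    then show ?thesis
      using False rot_3_eq(3)[of "i - 1" n] link_eq(2)[OF i1 i(2)]
      by (simp only: defs if_False if_True simp_thms)
  qed
  show "\<phi> (4 * i + 2) = (if i = n then 4 * n + 3 else 4 * (i + 1))"
  proof (cases "i = n")
    case True
    then show ?thesis
      using rot_3_eq(3)[OF n1 order.refl] link_eq(3)[OF i1 i(2)] n(1)
      by (simp only: defs if_False if_True simp_thms)
  next
    case False
    then have "1 \<le> i + 1" "i + 1 \<le> n" "even (i + 1)" using i by auto
    then show ?thesis
      using False rot_3_eq(2)[of "i + 1" n] link_eq(3)[OF i1 i(2)]
      by (simp only: defs if_False if_True simp_thms)
  qed
  show "\<phi> (4 * i + 3) = (if i = n then 5 else 4 * (i + 2) + 1)"
  proof (cases "i = n")
    case True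
    then show ?thesis
      using rot_3_eq(1)[of 1 n] link_eq(4)[OF i1 i(2)] n1 by (simp add: defs)
  next
    case False
    then have "1 \<le> i + 2" "i + 2 \<le> n" "odd (i + 2)" using i in1 by auto
    then show ?thesis
      using False in1 rot_3_eq(1)[of "i + 2" n] link_eq(4)[OF i1 i(2)]
      by (simp only: defs if_False if_True simp_thms)
  qed
qed

text \<open>
  Label 2 is the boundary and label 1 the \<open>k\<close>-gon of odd vertices. The label \<open>c > 2\<close> belongs to the
  triangle with vertices \<open>c - 2\<close>, \<open>c - 1\<close>, \<open>c\<close>.
\<close>

definition face_label :: "nat \<Rightarrow> nat \<Rightarrow> nat" where
  "face_label n h = (let i = h div 4; d = h mod 4 in
     if even i
     then if d = 0 then i else if d = 1 then i + 1 else if d = 2 \<and> i + 2 \<le> n then i + 2 else 2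
     else if d = 0 then 1 else if d = 1 then if i = 1 then 2 else i
     else if i = n then 2 else if d = 2 then i + 1 else i + 2)"

lemma face_label_eq:
  shows "face_label n (4 * i) = (if even i then i else 1)"
    and "face_label n (4 * i + 1) = (if even i then i + 1 else if i = 1 then 2 else i)"
    and "face_label n (4 * i + 2) =
      (if even i then if i + 2 \<le> n then i + 2 else 2 else if i = n then 2 else i + 1)"
    and "face_label n (4 * i + 3) = (if even i then 2 else if i = n then 2 else i + 2)"
proof -
  have "(4 * i + d) div 4 = i" "(4 * i + d) mod 4 = d" if "d < 4" for d
    using that by simp_all
  note * = this[of 0, simplified] this[of 1, simplified] this[of 2, simplified] this[of 3, simplified]
  show "face_label n (4 * i) = (if even i then i else 1)"
    by (simp add: face_label_def * del: One_nat_def)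
  show "face_label n (4 * i + 1) = (if even i then i + 1 else if i = 1 then 2 else i)"
    by (simp add: face_label_def * del: One_nat_def)
  show "face_label n (4 * i + 2) =
      (if even i then if i + 2 \<le> n then i + 2 else 2 else if i = n then 2 else i + 1)"
    by (simp add: face_label_def * del: One_nat_def)
  show "face_label n (4 * i + 3) = (if even i then 2 else if i = n then 2 else i + 2)"
    by (simp add: face_label_def * del: One_nat_def)
qed

lemma face_label_invariant:
  assumes n: "odd n" "7 \<le> n" and h: "h \<in> {4..<4 * n + 4}"
  shows "face_label n (face_perm (punctured_antiprism n) h) = face_label n h"
proof -
  let ?\<phi> = "face_perm (punctured_antiprism n)"
  \<comment> \<open>The numerals that occur in the exceptional branches of
    \<open>face_perm_even\<close> and \<open>face_perm_odd\<close>; all three half edges lie on the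
    boundary.\<close>
  have small: "face_label n 5 = 2" "face_label n 6 = 2" "face_label n 11 = 2"
    using face_label_eq(2)[of n 1] face_label_eq(3)[of n 1] face_label_eq(4)[of n 2] n by simp_all
  have even: "face_label n (?\<phi> (4 * i)) = face_label n (4 * i)"
    "face_label n (?\<phi> (4 * i + 1)) = face_label n (4 * i + 1)"
    "face_label n (?\<phi> (4 * i + 2)) = face_label n (4 * i + 2)"
    "face_label n (?\<phi> (4 * i + 3)) = face_label n (4 * i + 3)"
    if i: "even i" "1 \<le> i" "i \<le> n" for i
  proof -
    have i2: "2 \<le> i" using i by (cases "i = 1") auto
    have e: "i \<noteq> 1" "i \<noteq> n" "i - 2 + 2 = i" "odd (i - 1)" "odd (i + 1)" "i - 1 + 2 = i + 1"
      "i + 1 + 1 = i + 2" "i - 1 \<noteq> n" "i + 1 = n \<longleftrightarrow> \<not> i + 2 \<le> n" "even (i - 2)" "even (i + 2)"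
      using i i2 n by presburger+
    note \<phi> = face_perm_even[OF n i(1) i2 i(3)]
    show "face_label n (?\<phi> (4 * i)) = face_label n (4 * i)"
      unfolding \<phi> using small i e
        by (cases "i = 2") (simp_all only: face_label_eq if_True if_False simp_thms)
    show "face_label n (?\<phi> (4 * i + 1)) = face_label n (4 * i + 1)"
      unfolding \<phi> using e i by (simp only: face_label_eq if_True if_False simp_thms)
    show "face_label n (?\<phi> (4 * i + 2)) = face_label n (4 * i + 2)"
      unfolding \<phi> using e i
        by (cases "i + 2 \<le> n") (simp_all only: face_label_eq if_True if_False simp_thms)
    show "face_label n (?\<phi> (4 * i + 3)) = face_label n (4 * i + 3)"
      unfolding \<phi> using e i
        by (cases "i + 2 \<le> n") (simp_all only: face_label_eq if_True if_False simp_thms)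
  qed
  have odd: "face_label n (?\<phi> (4 * i)) = face_label n (4 * i)"
    "face_label n (?\<phi> (4 * i + 1)) = face_label n (4 * i + 1)"
    "face_label n (?\<phi> (4 * i + 2)) = face_label n (4 * i + 2)"
    "face_label n (?\<phi> (4 * i + 3)) = face_label n (4 * i + 3)"
    if i: "odd i" "i \<le> n" for i
  proof -
    have e: "i \<noteq> 2" "i \<noteq> 1 \<Longrightarrow> i - 1 + 1 = i" "even (i - 1)" "even (i + 1)" "i + 2 \<noteq> 1"
      "i \<noteq> 1 \<Longrightarrow> odd (i - 2)"  "odd (i + 2)"
      using i by presburger+
    note \<phi> = face_perm_odd[OF n i]
    show "face_label n (?\<phi> (4 * i)) = face_label n (4 * i)"
      unfolding \<phi> using e i n
        by (cases "i = 1") (simp_all only: face_label_eq if_True if_False simp_thms)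
    show "face_label n (?\<phi> (4 * i + 1)) = face_label n (4 * i + 1)"
      unfolding \<phi> using e i small
        by (cases "i = 1") (simp_all only: face_label_eq if_True if_False simp_thms)
    show "face_label n (?\<phi> (4 * i + 2)) = face_label n (4 * i + 2)"
      unfolding \<phi> using e i n
        by (cases "i = n") (simp_all only: face_label_eq if_True if_False simp_thms)
    show "face_label n (?\<phi> (4 * i + 3)) = face_label n (4 * i + 3)"
      unfolding \<phi> using e i n small
        by (cases "i = n") (simp_all only: face_label_eq if_True if_False simp_thms)
  qed
  from h show ?thesis
    using even odd by (cases rule: half_edge_cases4) metis+
qed

text \<open>For a triangle \<open>c > 2\<close> this is a half edge at its largest vertex. At
  \<open>c = 2\<close> the even formula gives \<open>8\<close>, an external half edge and so a point
  of the boundary; \<open>4\<close> lies on the k-gon of odd vertices.\<close>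

definition face_rep :: "nat \<Rightarrow> nat" where
  "face_rep c = (if even c then 4 * c else if c = 1 then 4 else 4 * c + 1)"

lemma face_perm_permutes:
  assumes "ribbon_graph G"
  shows "face_perm G permutes half_edges G"
  using assms unfolding ribbon_graph_def face_perm_def
  by (blast intro: permutes_compose permutes_inv)

text \<open>A triangle is at most one step, forwards or backwards, from its representative. Only the
  k-gon of odd vertices and the boundary, whose lengths grow with \<open>n\<close>, need
  induction.\<close>

lemma face_reach:
  assumes n: "odd n" "7 \<le> n" and h: "h \<in> {4..<4 * n + 4}"
  shows "h \<in> orbit (face_perm (punctured_antiprism n)) (face_rep (face_label n h))"
proof -
  let ?G = "punctured_antiprism n"
  define \<phi> where "\<phi> = face_perm ?G"
  have G: "ribbon_graph ?G" using n by (intro ribbon_graph_punctured_antiprism) simp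
  have \<phi>: "\<phi> permutes {4..<4 * n + 4}"
    using face_perm_permutes[OF G] by (simp add: \<phi>_def punctured_antiprism_def)
  have self: "x \<in> orbit \<phi> x" for x by (rule permutes_self_in_orbit[OF \<phi>]) simp
  have fwd: "y \<in> orbit \<phi> z" if "x \<in> orbit \<phi> z" "\<phi> x = y" for x y z
    using orbit.step[OF that(1)] that(2) by simp
  \<comment> \<open>On a finite set a cycle is also closed under preimages, so an arc may be
    followed against \<open>\<phi>\<close>.\<close>
  have bwd: "x \<in> orbit \<phi> z" if "y \<in> orbit \<phi> z" "\<phi> x = y" for x y z
    using cyclic_on_f_in[OF \<phi> cyclic_on_orbit[OF \<phi>]] that by blast
  note even = face_perm_even[OF n, folded \<phi>_def] and odd = face_perm_odd[OF n, folded \<phi>_def]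
  have rep: "face_rep c = 4 * c" if "even c" for c using that by (simp add: face_rep_def)
  have rep_odd: "face_rep c = 4 * c + 1" if "odd c" "c \<noteq> 1" for c
    using that by (simp add: face_rep_def)
  have rep1: "face_rep 1 = 4" by (simp add: face_rep_def)

  \<comment> \<open>Along this face \<open>\<phi>\<close> descends by two vertices, so the induction
    climbs from \<open>4\<close> backwards.\<close>
  have ring: "4 * (2 * k + 1) \<in> orbit \<phi> 4" if "2 * k + 1 \<le> n" for k
    using that
  proof (induction k)
    case 0
    show ?case using self[of 4] by simp
  next
    case (Suc k)
    have "\<phi> (4 * (2 * Suc k + 1)) = 4 * (2 * k + 1)"
      using odd(1)[of "2 * Suc k + 1"] Suc.prems by simp
    moreover have "4 * (2 * k + 1) \<in> orbit \<phi> 4" using Suc by simp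
    ultimately show ?case using bwd by blast
  qed

  \<comment> \<open>The boundary walk starts at \<open>8\<close> and passes the half edges
    \<open>4 * i + 3\<close> of all even \<open>i\<close> up to \<open>n - 1\<close>. It returns
    through \<open>4 * (n - 1) + 2\<close>, \<open>4 * n + 2\<close>, \<open>4 * n + 3\<close>,
    \<open>5\<close> and \<open>6\<close>; this second arc is followed backwards from
    \<open>8\<close>.\<close>
  have "\<phi> 8 = 11" using even(1)[of 2] n by simp
  then have b11: "11 \<in> orbit \<phi> 8" using fwd self by blast
  have outer: "4 * (2 * k + 2) + 3 \<in> orbit \<phi> 8" if "2 * k + 2 \<le> n" for k
    using that
  proof (induction k)
    case 0
    show ?case using b11 by simp
  next
    case (Suc k)
    have "\<phi> (4 * (2 * k + 2) + 3) = 4 * (2 * Suc k + 2) + 3"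
      using even(4)[of "2 * k + 2"] Suc.prems by simp
    moreover have "4 * (2 * k + 2) + 3 \<in> orbit \<phi> 8" using Suc by simp
    ultimately show ?case using fwd by blast
  qed
  have n1: "even (n - 1)" "2 \<le> n - 1" "n - 1 \<le> n" "\<not> n - 1 + 2 \<le> n" "n - 1 + 1 = n"
    using n by presburger+
  have "\<phi> 6 = 8" using odd(3)[of 1] n by simp
  then have b6: "6 \<in> orbit \<phi> 8" using bwd self by blast
  have "\<phi> 5 = 6" using odd(2)[of 1] n by simp
  then have b5: "5 \<in> orbit \<phi> 8" using bwd b6 by blast
  have "\<phi> (4 * n + 3) = 5" using odd(4)[of n] n by simp
  then have bn3: "4 * n + 3 \<in> orbit \<phi> 8" using bwd b5 by blast
  have "\<phi> (4 * n + 2) = 4 * n + 3" using odd(3)[of n] n by simp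
  then have bn2: "4 * n + 2 \<in> orbit \<phi> 8" using bwd bn3 by blast
  have "\<phi> (4 * (n - 1) + 2) = 4 * n + 2" using even(3)[OF n1(1-3)] n1(5) by simp
  then have bl2: "4 * (n - 1) + 2 \<in> orbit \<phi> 8" using bwd bn2 by blast

  have rep2: "face_rep 2 = 8" by (simp add: face_rep_def)
  have "h \<in> orbit \<phi> (face_rep (face_label n h))"
    if "\<exists>c r. face_label n h = c \<and> face_rep c = r \<and> h \<in> orbit \<phi> r"
    using that by auto
  moreover from h have "\<exists>c r. face_label n h = c \<and> face_rep c = r \<and> h \<in> orbit \<phi> r"
  proof (cases rule: half_edge_cases4)
    case (1 i)
    show ?thesis
    proof (cases "even i")
      case True
      then have "face_label n h = i" using 1(3) by (simp only: face_label_eq if_True simp_thms)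
      then show ?thesis using 1(3) self[of h] rep[OF True] by metis
    next
      case False
      then have l: "face_label n h = 1" using 1(3) by (simp only: face_label_eq if_False simp_thms)
      obtain k where k: "i = 2 * k + 1" using False by (rule oddE)
      then have "h \<in> orbit \<phi> 4" using 1 ring[of k] by (simp only:)
      then show ?thesis using l rep1 by blast
    qed
  next
    case (2 i)
    show ?thesis
    proof (cases "even i")
      case True
      then have i: "i + 1 \<le> n" "odd (i + 1)" "i + 1 \<noteq> 1" using 2 n by presburger+
      have l: "face_label n h = i + 1" using 2(3) True
        by (simp only: face_label_eq if_True simp_thms)
      have "\<phi> (4 * (i + 1) + 1) = h" using odd(2)[OF i(2,1)] 2 i(3) by simp
      then have "h \<in> orbit \<phi> (4 * (i + 1) + 1)" using fwd self by blast
      then show ?thesis using l rep_odd[OF i(2,3)] by blast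
    next
      case False
      show ?thesis
      proof (cases "i = 1")
        case True
        then have "face_label n h = 2" using 2(3) False
          by (simp only: face_label_eq if_True if_False simp_thms)
        moreover have "h \<in> orbit \<phi> 8" using b5 2(3) True by simp
        ultimately show ?thesis using rep2 by blast
      next
        case i1: False
        then have "face_label n h = i" using 2(3) False
          by (simp only: face_label_eq if_False simp_thms)
        then show ?thesis using 2(3) self[of h] rep_odd[OF False i1] by metis
      qed
    qed
  next
    case (3 i)
    consider (a) "even i" "i + 2 \<le> n" | (b) "even i" "\<not> i + 2 \<le> n" | (c) "odd i" "i \<noteq> n"
      | (d) "odd i" "i = n" by blast
    then show ?thesis
    proof cases
      case a
      then have l: "face_label n h = i + 2" using 3(3)
        by (simp only: face_label_eq if_True simp_thms)
      have "even (i + 2)" "2 \<le> i + 2" "i + 2 \<noteq> 2" "i + 2 - 2 = i" using a 3 by auto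
      then have "\<phi> (4 * (i + 2)) = h" "face_rep (i + 2) = 4 * (i + 2)"
        using even(1)[of "i + 2"] 3(3) a(2) rep by (simp_all only: if_False simp_thms)
      moreover from this have "h \<in> orbit \<phi> (4 * (i + 2))" using fwd self by blast
      ultimately show ?thesis using l by blast
    next
      case b
      then have "face_label n h = 2" using 3(3)
        by (simp only: face_label_eq if_True if_False simp_thms)
      moreover have "i = n - 1" using b 3 n by presburger
      then have "h \<in> orbit \<phi> 8" using bl2 3(3) by (simp only:)
      ultimately show ?thesis using rep2 by blast
    next
      case c
      then have l: "face_label n h = i + 1" using 3(3)
        by (simp only: face_label_eq if_False simp_thms)
      have "\<phi> h = 4 * (i + 1)" "even (i + 1)" using odd(3)[of i] 3 c by simp_all
      moreover from this have "h \<in> orbit \<phi> (4 * (i + 1))" using bwd self by blast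
      ultimately show ?thesis using l rep by blast
    next
      case d
      then have "face_label n h = 2" using 3(3) n(1)
        by (simp only: face_label_eq if_True if_False simp_thms)
      moreover have "h \<in> orbit \<phi> 8" using bn2 3(3) d by (simp only:)
      ultimately show ?thesis using rep2 by blast
    qed
  next
    case (4 i)
    consider (a) "even i" | (b) "odd i" "i \<noteq> n" | (c) "odd i" "i = n" by blast
    then show ?thesis
    proof cases
      case a
      then have "face_label n h = 2" using 4(3) by (simp only: face_label_eq if_True simp_thms)
      moreover obtain k where "i = 2 * k" using a by (rule evenE)
      then have k: "i = 2 * (k - 1) + 2" using 4(1) by simp
      have "h \<in> orbit \<phi> 8" using outer[of "k - 1"] 4(2,3) unfolding k[symmetric] by simp
      ultimately show ?thesis using rep2 by blast
    next
      case b
      then have l: "face_label n h = i + 2" using 4(3)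
        by (simp only: face_label_eq if_False simp_thms)
      have "\<phi> h = 4 * (i + 2) + 1" using odd(4)[of i] 4 b by (simp only: if_False simp_thms)
      moreover from this have "h \<in> orbit \<phi> (4 * (i + 2) + 1)" using bwd self by blast
      moreover have "face_rep (i + 2) = 4 * (i + 2) + 1"
        using b 4(1) by (intro rep_odd) auto
      ultimately show ?thesis using l by blast
    next
      case c
      then have "face_label n h = 2" using 4(3) n(1)
        by (simp only: face_label_eq if_True if_False simp_thms)
      moreover have "h \<in> orbit \<phi> 8" using bn3 4(3) c by (simp only:)
      ultimately show ?thesis using rep2 by blast
    qed
  qed
  ultimately have "h \<in> orbit \<phi> (face_rep (face_label n h))" by blast
  then show ?thesis by (simp add: \<phi>_def)
qed

lemma face_label_image:
  assumes n: "odd n" "7 \<le> n"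
  shows "face_label n ` {4..<4 * n + 4} = {1..n}"
proof (intro equalityI subsetI)
  fix c assume "c \<in> face_label n ` {4..<4 * n + 4}"
  then obtain h where h: "h \<in> {4..<4 * n + 4}" "c = face_label n h" by blast
  from h(1) show "c \<in> {1..n}"
  proof (cases rule: half_edge_cases4)
    case (1 i)
    then show ?thesis using h(2) by (simp add: face_label_eq)
  next
    case (2 i)
    then have "even i \<Longrightarrow> i + 1 \<le> n" using n by presburger
    then show ?thesis using h(2) 2 n by (simp add: face_label_eq)
  next
    case (3 i)
    then show ?thesis using h(2) n by (simp add: face_label_eq)
  next
    case (4 i)
    then have "odd i \<Longrightarrow> i \<noteq> n \<Longrightarrow> i + 2 \<le> n"
      using n by presburger
    then show ?thesis using h(2) 4 n by (simp add: face_label_eq)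
  qed
next
  fix c assume c: "c \<in> {1..n}"
  have "c = face_label n (face_rep c)"
    using face_label_eq(1)[of n 1] by (auto simp: face_rep_def face_label_eq)
  moreover have "face_rep c \<in> {4..<4 * n + 4}"
    using c by (auto simp: face_rep_def)
  ultimately show "c \<in> face_label n ` {4..<4 * n + 4}" by blast
qed

text \<open>The count agrees with the antiprism: its \<open>2 * k\<close> triangles and two k-gons
  are \<open>n + 3\<close> faces, and the four around vertex 0 become one.\<close>

lemma faces_punctured_antiprism:
  assumes n: "odd n" "7 \<le> n"
  shows "faces (punctured_antiprism n) = (\<lambda>c. {h \<in> {4..<4 * n + 4}. face_label n h = c}) ` {1..n}"
    and "card (faces (punctured_antiprism n)) = n"
proof -
  have p: "face_perm (punctured_antiprism n) permutes {4..<4 * n + 4}"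
    using face_perm_permutes[OF ribbon_graph_punctured_antiprism, of n] n
    by (simp add: punctured_antiprism_def)
  note * = perm_cycles_eq_label_classes[OF p finite_atLeastLessThan face_label_invariant[OF n]
      face_reach[OF n] face_label_image[OF n]]
  show "faces (punctured_antiprism n) = (\<lambda>c. {h \<in> {4..<4 * n + 4}. face_label n h = c}) ` {1..n}"
    using *(1) by (simp add: faces_def punctured_antiprism_def)
  show "card (faces (punctured_antiprism n)) = n"
    using *(2) by (simp add: faces_def punctured_antiprism_def)
qed

text \<open>All four external half edges carry the label 2, so no other face meets them.\<close>

lemma boundary_lengths_punctured_antiprism:
  assumes n: "odd n" "7 \<le> n"
  shows "boundary_lengths (punctured_antiprism n) = {#4#}"
proof -
  let ?G = "punctured_antiprism n"
  let ?face = "\<lambda>c. {h \<in> {4..<4 * n + 4}. face_label n h = c}"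
  have n4: "4 \<le> n" using n by simp
  have ext: "external_half_edges ?G \<subseteq> ?face 2"
  proof -
    have "4 * n - 1 = 4 * (n - 1) + 3" "even (n - 1)" using n by presburger+
    then have "face_label n (4 * n - 1) = 2" by (simp only: face_label_eq if_True simp_thms)
    moreover have "face_label n 5 = 2" "face_label n 8 = 2" "face_label n (4 * n + 2) = 2"
      using face_label_eq(2)[of n 1] face_label_eq(1)[of n 2] face_label_eq(3)[of n n] n by simp_all
    moreover have "x \<in> {4..<4 * n + 4}" if "x \<in> {5, 8, 4 * n - 1, 4 * n + 2}" for x
      using that n by (elim insertE) auto
    ultimately show ?thesis
      unfolding external_punctured_antiprism[OF n4]
        by (intro subsetI CollectI conjI) (assumption, elim insertE, simp_all only: empty_iff)
  qed
  have card: "card (external_half_edges ?G) = 4"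
    by (rule card_external_punctured_antiprism[OF n4])
  then have ne: "external_half_edges ?G \<noteq> {}" by auto
  have disj: "?face c \<inter> external_half_edges ?G = {}" if "c \<noteq> 2" for c
    using ext that by blast
  have "?face 2 \<in> faces ?G" unfolding faces_punctured_antiprism(1)[OF n] using n by auto
  moreover have "?face 2 \<inter> external_half_edges ?G \<noteq> {}" using ext ne by blast
  moreover have "f = ?face 2"
    if f: "f \<in> faces ?G" "f \<inter> external_half_edges ?G \<noteq> {}" for f
  proof -
    obtain c where c: "f = ?face c"
      using f(1) unfolding faces_punctured_antiprism(1)[OF n] by (rule imageE)
    then have "c = 2" using disj[of c] f(2) by argo
    then show ?thesis by (simp only: c)
  qed
  ultimately have "boundaries ?G = {?face 2}"
    unfolding boundaries_def internal_faces_def by blast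
  then show ?thesis
    using card ext by (simp add: boundary_lengths_def boundary_length_def Int_absorb1)
qed

lemma has_genus_punctured_antiprism:
  assumes n: "odd n" "7 \<le> n"
  shows "has_genus (punctured_antiprism n) 0"
proof -
  let ?G = "punctured_antiprism n"
  have n4: "4 \<le> n" using n by simp
  \<comment> \<open>This gives \<open>2 * n - 2\<close> internal edges; with \<open>n\<close>
    vertices and \<open>n\<close> faces the Euler sum is 2.\<close>
  have "2 * card (internal_edges ?G) + 4 = 4 * n"
    using card_internal_edges[OF ribbon_graph_punctured_antiprism[OF n4]]
      card_external_punctured_antiprism[OF n4]
    by (simp add: punctured_antiprism_def)
  then show ?thesis
    using vertices_punctured_antiprism(1)[OF n4] faces_punctured_antiprism(2)[OF n]
    by (simp add: has_genus_def)
qed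

section \<open>Connectivity\<close>

text \<open>The rotation is transitive on the half edges of a vertex. A set closed under it is thus
  a union of vertices and can be replaced by a predicate \<open>W\<close> on vertex numbers.\<close>

lemma rot_closed_vertex:
  assumes S: "S \<subseteq> {4..<4 * n + 4}" "\<And>h. h \<in> S \<Longrightarrow> rot n 1 h \<in> S"
    and h: "h \<in> S" and k: "k \<in> {4..<4 * n + 4}" "k div 4 = h div 4"
  shows "k \<in> S"
proof -
  have p: "rot n 1 permutes {4..<4 * n + 4}" by (rule rot_permutes) simp
  have "orbit (rot n 1) h = {x \<in> {4..<4 * n + 4}. x div 4 = h div 4}"
    using S(1) h
    by (intro orbit_eq_label_class[OF p finite_atLeastLessThan rot_div rot_reach]) auto
  then have "k \<in> orbit (rot n 1) h" using k by blast
  then show ?thesis by induct (use S(2) h in auto)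
qed

text \<open>A cycle without one edge is still a path. If the missing edge joins \<open>j\<close> and
  \<open>j + 1\<close>, values spread from 1 up to \<open>j\<close> and from \<open>n\<close> down
  to \<open>j + 1\<close>, and \<open>wrap\<close> joins the two arcs. A \<open>j\<close> outside
  \<open>1..n - 1\<close> says that the chain from 1 to \<open>n\<close> is intact, while the
  closing edge may be missing.\<close>

lemma cyclic_chain_const:
  fixes W :: "nat \<Rightarrow> bool"
  assumes step: "\<And>i. \<lbrakk>1 \<le> i; i < n; i \<noteq> j\<rbrakk> \<Longrightarrow> W i = W (i + 1)"
    and wrap: "1 \<le> j \<Longrightarrow> j < n \<Longrightarrow> W 1 = W n"
    and i: "1 \<le> i" "i \<le> n"
  shows "W i = W 1"
proof -
  have up: "W k = W 1" if "k \<le> j \<or> \<not> (1 \<le> j \<and> j < n)" "k \<le> n" "1 \<le> k" for k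
    using that(3,1,2)
  proof (induction k rule: dec_induct)
    case base
    show ?case by simp
  next
    case (step k)
    then show ?case using assms(1)[of k] by (auto simp: Suc_eq_plus1)
  qed
  have down: "W k = W n" if "j < k" "1 \<le> j" "k \<le> n" for k
    using that(3,1,2)
  proof (induction k rule: inc_induct)
    case base
    show ?case by simp
  next
    case (step k)
    then show ?case using assms(1)[of k] by (auto simp: Suc_eq_plus1)
  qed
  show ?thesis
  proof (cases "i \<le> j \<or> \<not> (1 \<le> j \<and> j < n)")
    case True
    then show ?thesis using up i by blast
  next
    case False
    then show ?thesis using down[of i] wrap i by auto
  qed
qed

text \<open>The links \<open>4 * i + 2 \<leftrightarrow> 4 * i + 5\<close> together with \<open>4 \<leftrightarrow> 4 * n + 3\<close> form a Hamiltonian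
  cycle, which stays connected after the removal of one edge.\<close>

lemma closed_under_cut_eq:
  assumes n: "4 \<le> n"
    and S: "S \<subseteq> {4..<4 * n + 4}" "S \<noteq> {}" "\<And>h. h \<in> S \<Longrightarrow> rot n 1 h \<in> S"
    and cut: "\<And>h. h \<in> S \<Longrightarrow> h \<notin> {a, link n a} \<Longrightarrow> link n h \<in> S"
  shows "S = {4..<4 * n + 4}"
proof -
  define W where "W i \<longleftrightarrow> 4 * i \<in> S" for i
  have mem: "4 * i + d \<in> S \<longleftrightarrow> W i" if "1 \<le> i" "i \<le> n" "d < 4" for i d
    unfolding W_def
    using rot_closed_vertex[OF S(1,3), of "4 * i" "4 * i + d"]
      rot_closed_vertex[OF S(1,3), of "4 * i + d" "4 * i"] that by auto
  have inv: "link n (link n h) = h" for h by (rule link_link[OF n])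
  have edge: "h \<in> S \<longleftrightarrow> link n h \<in> S" if "h \<notin> {a, link n a}" for h
  proof -
    have "link n h \<notin> {a, link n a}" using that inv by (metis insert_iff empty_iff)
    then show ?thesis using cut that inv by metis
  qed
  have chain_link: "link n (4 * i + 2) = 4 * (i + 1) + 1" if "1 \<le> i" "i < n" for i
    using link_eq(3)[of i n] that by simp
  have chain: "W i = W (i + 1)" if "1 \<le> i" "i < n" "4 * i + 2 \<notin> {a, link n a}" for i
    using edge[OF that(3)] mem[of i 2] mem[of "i + 1" 1] chain_link[of i] that by simp
  have wrap: "W 1 = W n" if "4 \<notin> {a, link n a}"
    using edge[OF that] mem[of 1 0] mem[of n 3] link_eq(1)[of 1 n] n by simp
  obtain j where j: "\<And>i. \<lbrakk>1 \<le> i; i < n; i \<noteq> j\<rbrakk> \<Longrightarrow> W i = W (i + 1)"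
    "1 \<le> j \<Longrightarrow> j < n \<Longrightarrow> W 1 = W n"
  proof (cases "\<exists>j. 1 \<le> j \<and> j < n \<and> 4 * j + 2 \<in> {a, link n a}")
    case True
    then obtain j where j: "1 \<le> j" "j < n" "4 * j + 2 \<in> {a, link n a}" by blast
    then have e: "{a, link n a} = {4 * j + 2, 4 * (j + 1) + 1}"
      using chain_link[OF j(1,2)] inv[of a] by auto
    have "4 * i + 2 \<notin> {a, link n a}" if "i \<noteq> j" for i
      unfolding e using that by auto
    moreover have "4 \<notin> {a, link n a}" unfolding e by auto
    ultimately show ?thesis using chain wrap that by blast
  next
    case False
    \<comment> \<open>The value 0 encodes that no edge of the chain is cut.\<close>
    then show ?thesis by (intro that[of 0] chain) auto
  qed
  have const: "W i = W 1" if "1 \<le> i" "i \<le> n" for i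
    using cyclic_chain_const[of n j W i] j that by blast
  obtain x where x: "x \<in> S" using S(2) by blast
  then have "x \<in> {4..<4 * n + 4}" using S(1) by blast
  then obtain i d where "x = 4 * i + d" "1 \<le> i" "i \<le> n" "d < 4" by (rule half_edge_cases)
  then have "W 1" using x mem const by metis
  have "y \<in> S" if y: "y \<in> {4..<4 * n + 4}" for y
  proof -
    obtain k e where "y = 4 * k + e" "1 \<le> k" "k \<le> n" "e < 4" using y
      by (rule half_edge_cases)
    then show ?thesis using mem const \<open>W 1\<close> by metis
  qed
  then show ?thesis using S(1) by blast
qed

lemma component_sets_punctured_antiprism:
  assumes n: "4 \<le> n"
  shows "component_sets (punctured_antiprism n) = {half_edges (punctured_antiprism n)}"
proof (rule one_component[OF ribbon_graph_punctured_antiprism[OF n]])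
  show "half_edges (punctured_antiprism n) \<noteq> {}"
    using n by (simp add: punctured_antiprism_def)
  fix S
  assume "S \<subseteq> half_edges (punctured_antiprism n)" "S \<noteq> {}"
    "\<And>h. h \<in> S \<Longrightarrow> vert_perm (punctured_antiprism n) h \<in> S"
    "\<And>h. h \<in> S \<Longrightarrow> edge_inv (punctured_antiprism n) h \<in> S"
  then show "S = half_edges (punctured_antiprism n)"
    \<comment> \<open>Closure under all links implies closure under all links but one, so any
      \<open>a\<close> will do.\<close>
    using closed_under_cut_eq[OF n, of S] by (simp add: punctured_antiprism_def)
qed

lemma bridgeless_punctured_antiprism:
  assumes n: "4 \<le> n"
  shows "bridgeless (punctured_antiprism n)"
  unfolding bridgeless_def
proof
  let ?G = "punctured_antiprism n"
  note G = ribbon_graph_punctured_antiprism[OF n]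
  fix e assume e: "e \<in> internal_edges ?G"
  then obtain a where a: "e = {a, link n a}"
    unfolding internal_edges_eq[OF G] by (auto simp: punctured_antiprism_def)
  have half: "half_edges (cut_edge ?G e) = {4..<4 * n + 4}"
    by (simp add: cut_edge_def punctured_antiprism_def)
  have "component_sets (cut_edge ?G e) = {half_edges (cut_edge ?G e)}"
  proof (rule one_component[OF ribbon_graph_cut_edge[OF G e]])
    show "half_edges (cut_edge ?G e) \<noteq> {}" using n by (simp add: half)
    fix S
    assume S: "S \<subseteq> half_edges (cut_edge ?G e)" "S \<noteq> {}"
      "\<And>h. h \<in> S \<Longrightarrow> vert_perm (cut_edge ?G e) h \<in> S"
      "\<And>h. h \<in> S \<Longrightarrow> edge_inv (cut_edge ?G e) h \<in> S"
    have "rot n 1 h \<in> S" if "h \<in> S" for h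
      using S(3)[OF that] by (simp add: cut_edge_def punctured_antiprism_def)
    moreover have "link n h \<in> S" if "h \<in> S" "h \<notin> {a, link n a}" for h
      using S(4)[OF that(1)] that(2)
      by (simp add: cut_edge_def punctured_antiprism_def perm_restrict_def a)
    ultimately show "S = half_edges (cut_edge ?G e)"
      using closed_under_cut_eq[OF n, of S a] S(1,2) half by simp
  qed
  then show "component_sets (cut_edge ?G e) = component_sets ?G"
    unfolding component_sets_punctured_antiprism[OF n] half by (simp add: punctured_antiprism_def)
qed

lemma divergent_punctured_antiprism:
  assumes n: "odd n" "7 \<le> n"
  shows "divergent (punctured_antiprism n)"
proof -
  have n4: "4 \<le> n" using n by simp
  show ?thesis
    unfolding divergent_def
    using ribbon_graph_punctured_antiprism[OF n4] bridgeless_punctured_antiprism[OF n4]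
      connected_graph_if_one_component[OF component_sets_punctured_antiprism[OF n4]]
      has_genus_punctured_antiprism[OF n] boundary_lengths_punctured_antiprism[OF n]
      vertices_punctured_antiprism(2)[OF n4] by blast
qed

section \<open>Edge cuts and primitivity\<close>

lemma five_le_card:
  assumes "finite D" "a \<in> D" "b \<in> D" "c \<in> D" "d \<in> D" "e \<in> D" "distinct [a, b, c, d, e]"
  shows "5 \<le> card D"
proof -
  have "card (set [a, b, c, d, e]) = 5" using distinct_card[OF assms(7)] by simp
  moreover have "set [a, b, c, d, e] \<subseteq> D" using assms by simp
  ultimately show ?thesis using card_mono[OF assms(1)] by metis
qed

text \<open>Five half edges are exhibited near the extreme vertices of the set, or near the extreme
  gaps if it contains both 1 and \<open>n\<close>. The count is the size of \<open>S\<close> minus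
  twice the number of links inside it, hence even, so that at least six are in fact present; five
  already exceeds what a divergent component allows.\<close>

lemma cut_size:
  assumes n: "odd n" "7 \<le> n"
    and S: "S \<subseteq> {4..<4 * n + 4}" "\<And>h. h \<in> S \<Longrightarrow> rot n 1 h \<in> S" "S \<noteq> {4..<4 * n + 4}"
    and xy: "x \<in> S" "y \<in> S" "x div 4 \<noteq> y div 4"
  shows "5 \<le> card {h \<in> S. link n h = h \<or> link n h \<notin> S}"
proof -
  let ?D = "{h \<in> S. link n h = h \<or> link n h \<notin> S}"
  define W where "W i \<longleftrightarrow> 4 * i \<in> S" for i
  have range: "1 \<le> i \<and> i \<le> n" if "W i" for i
    using that S(1) by (auto simp: W_def)
  have mem: "4 * i + d \<in> S \<longleftrightarrow> W i" if "d < 4" for i d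
  proof (cases "1 \<le> i \<and> i \<le> n")
    case True
    then show ?thesis
      unfolding W_def
      using rot_closed_vertex[OF S(1,2), of "4 * i" "4 * i + d"]
        rot_closed_vertex[OF S(1,2), of "4 * i + d" "4 * i"] that by auto
  next
    case False
    then have "4 * i + d \<notin> {4..<4 * n + 4}" using that by auto
    then show ?thesis using False range S(1) by blast
  qed
  have mem': "4 * i \<in> S \<longleftrightarrow> W i" "4 * i + 1 \<in> S \<longleftrightarrow> W i" "4 * i + 2 \<in> S \<longleftrightarrow> W i"
    "4 * i + 3 \<in> S \<longleftrightarrow> W i" for i
    using mem[of 1 i] mem[of 2 i] mem[of 3 i] by (simp_all add: W_def)
  \<comment> \<open>As \<open>W\<close> fails at 0 and beyond \<open>n\<close>, the facts
    \<open>D0\<close> to \<open>D3\<close> treat external half edges like those that leave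
    \<open>S\<close>. Only the edge between 1 and \<open>n\<close> needs the separate facts
    \<open>D0'\<close> and \<open>D3'\<close>.\<close>
  have D0: "4 * i \<in> ?D" if "W i" "2 \<le> i" "\<not> W (i - 2)" for i
    using link_eq(1)[of i n] range[OF that(1)] that mem' mem'(1)[of 2] mem'(4)[of "i - 2"]
      by (cases "i = 2") auto
  have D0': "4 \<in> ?D" if "W 1" "\<not> W n"
    using link_eq(1)[of 1 n] n that mem'(1)[of 1] mem'(4)[of n] by simp
  have D1: "4 * i + 1 \<in> ?D" if "W i" "\<not> W (i - 1)" for i
    using link_eq(2)[of i n] range[OF that(1)] that mem' mem'(2)[of 1] mem'(3)[of "i - 1"]
      by (cases "i = 1") auto
  have D2: "4 * i + 2 \<in> ?D" if "W i" "\<not> W (i + 1)" for i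
    using link_eq(3)[of i n] range[OF that(1)] that mem' mem'(2)[of "i + 1"] by (cases "i = n") auto
  have D3: "4 * i + 3 \<in> ?D" if "W i" "i < n" "\<not> W (i + 2)" for i
    using link_eq(4)[of i n] range[OF that(1)] that mem' mem'(1)[of "i + 2"]
      by (cases "i = n - 1") auto
  have D3': "4 * n + 3 \<in> ?D" if "W n" "\<not> W 1"
    using link_eq(4)[of n n] n that mem'(1)[of 1] mem'(4)[of n] by simp
  have fin: "finite ?D" using finite_subset[OF S(1)] by simp

  have Wdiv: "W (h div 4)" if "h \<in> S" for h
    using mem[of "h mod 4" "h div 4"] that by simp
  have finW: "finite {i. W i}"
    by (rule finite_subset[of _ "{1..n}"]) (use range in auto)
  define p where "p = Min {i. W i}"
  define q where "q = Max {i. W i}"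
  have "{i. W i} \<noteq> {}" using Wdiv xy by blast
  then have p: "W p" "\<And>i. W i \<Longrightarrow> p \<le> i" and q: "W q" "\<And>i. W i \<Longrightarrow> i \<le> q"
    using finW Min_in[of "{i. W i}"] Max_in[of "{i. W i}"] by (auto simp: p_def q_def)
  have pq: "p < q"
  proof -
    have "p \<le> x div 4" "p \<le> y div 4" "x div 4 \<le> q" "y div 4 \<le> q"
      using p q Wdiv xy by auto
    then show ?thesis using xy(3) by linarith
  qed
  note pn = range[OF p(1)] and qn = range[OF q(1)]
  have not_p: "\<not> W i" if "i < p" for i using p(2)[of i] that by auto
  have not_q: "\<not> W i" if "q < i" for i using q(2)[of i] that by auto
  show ?thesis
  proof (cases "p = 1 \<and> q = n")
    case False
    \<comment> \<open>Both downward half edges at \<open>p\<close> and both upward ones at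
      \<open>q\<close> leave the set. Even if \<open>p = 1\<close> or \<open>q = n\<close>, the edge
      between 1 and \<open>n\<close> leaves, because exactly one of its ends is in the set.\<close>
    have 1: "4 * p + 1 \<in> ?D" using p(1) pn by (intro D1 not_p) auto
    have 2: "4 * q + 2 \<in> ?D" using q(1) by (intro D2 not_q) auto
    have 3: "4 * p \<in> ?D"
    proof (cases "p = 1")
      case True
      then have "4 \<in> ?D" using False p(1) qn by (intro D0' not_q) auto
      then show ?thesis using True by simp
    next
      case False
      then show ?thesis using p(1) pn by (intro D0 not_p) auto
    qed
    have 4: "4 * q + 3 \<in> ?D"
    proof (cases "q = n")
      case True
      then have "4 * n + 3 \<in> ?D" using False q(1) pn by (intro D3' not_p) auto
      then show ?thesis using True by simp
    next
      case False
      then show ?thesis using q(1) qn by (intro D3 not_q) auto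
    qed
    \<comment> \<open>The fifth one: if \<open>p + 1\<close> is in the set, its edge towards
      \<open>p - 1\<close> leaves; otherwise the edge from \<open>p\<close> to \<open>p + 1\<close>
      does.\<close>
    obtain f where f: "f \<in> ?D" "f = 4 * (p + 1) \<or> f = 4 * p + 2"
    proof (cases "W (p + 1)")
      case True
      then have "4 * (p + 1) \<in> ?D" using pn by (intro D0 not_p) auto
      then show ?thesis using that by blast
    next
      case False
      then show ?thesis using D2 p(1) that by blast
    qed
    have dist: "distinct [4 * p + 1, 4 * q + 2, 4 * p, 4 * q + 3, f]"
    proof -
      have "4 * p + 1 \<noteq> 4 * q + 2" "4 * p + 1 \<noteq> 4 * p" "4 * p + 1 \<noteq> 4 * q + 3" "4 * p + 1 \<noteq> f"
        "4 * q + 2 \<noteq> 4 * p" "4 * q + 2 \<noteq> 4 * q + 3" "4 * q + 2 \<noteq> f"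
        "4 * p \<noteq> 4 * q + 3" "4 * p \<noteq> f" "4 * q + 3 \<noteq> f"
        using f(2) pq by presburger+
      then show ?thesis by auto
    qed
    show ?thesis by (rule five_le_card[OF fin 1 2 3 4 f(1) dist])
  next
    case True
    then have W: "W 1" "W n" using p q by auto
    have out: "\<not> W i" if "i = 0 \<or> n < i" for i using range[of i] that by auto
    have 1: "5 \<in> ?D" using D1[of 1] W(1) out[of 0] by simp
    have 2: "4 * n + 2 \<in> ?D" using D2[of n] W(2) out[of "n + 1"] by simp
    have not_all: "\<exists>i. 1 \<le> i \<and> i \<le> n \<and> \<not> W i"
    proof (rule ccontr)
      assume *: "\<not> ?thesis"
      have "h \<in> S" if "h \<in> {4..<4 * n + 4}" for h
        using that by (rule half_edge_cases) (use * mem in auto)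
      then show False using S(1,3) by blast
    qed
    define R where "R = {i. 1 \<le> i \<and> i \<le> n \<and> \<not> W i}"
    have R: "finite R" "R \<noteq> {}" using not_all by (auto simp: R_def)
    define r where "r = Min R"
    define s where "s = Max R"
    have r: "r \<in> R" "\<And>i. i \<in> R \<Longrightarrow> r \<le> i" and s: "s \<in> R" "\<And>i. i \<in> R \<Longrightarrow> i \<le> s"
      using R by (simp_all add: r_def s_def)
    have rW: "1 < r" "r < n" "\<not> W r" "W (r - 1)"
    proof -
      show "1 < r" "r < n" "\<not> W r" using r(1) W by (auto simp: R_def le_less)
      then have "\<not> r \<le> r - 1" "1 \<le> r - 1" "r - 1 \<le> n" by linarith+
      then show "W (r - 1)" using r(2)[of "r - 1"] unfolding R_def by blast
    qed
    have sW: "1 < s" "s < n" "\<not> W s" "W (s + 1)"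
    proof -
      show "1 < s" "s < n" "\<not> W s" using s(1) W by (auto simp: R_def le_less)
      then have "\<not> s + 1 \<le> s" "1 \<le> s + 1" "s + 1 \<le> n" by linarith+
      then show "W (s + 1)" using s(2)[of "s + 1"] unfolding R_def by blast
    qed
    \<comment> \<open>Besides the external half edges at 1 and \<open>n\<close>, vertex 2
      contributes its own external half edge, or else the edge from 1 to 2 leaves; \<open>g\<close>
      is the mirror image at \<open>n - 1\<close>.\<close>
    obtain f where f: "f \<in> ?D" "f = 8 \<and> W 2 \<or> f = 6 \<and> \<not> W 2"
    proof (cases "W 2")
      case True
      then have "8 \<in> ?D" using D0[of 2] out[of 0] by simp
      then show ?thesis using True that by blast
    next
      case False
      then have "6 \<in> ?D" using D2[of 1] W(1) by simp
      then show ?thesis using False that by blast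
    qed
    obtain g where g: "g \<in> ?D" "g = 4 * (n - 1) + 3 \<and> W (n - 1) \<or> g = 4 * n + 1 \<and> \<not> W (n - 1)"
    proof (cases "W (n - 1)")
      case True
      have "\<not> W (n - 1 + 2)" by (rule out) (use n in presburger)
      moreover have "n - 1 < n" using n by simp
      ultimately have "4 * (n - 1) + 3 \<in> ?D" using True by (intro D3)
      then show ?thesis using True that by blast
    next
      case False
      then show ?thesis using D1 W(2) that by blast
    qed
    have f': "f = 8 \<or> f = 6" and g': "g = 4 * (n - 1) + 3 \<or> g = 4 * n + 1"
      using f(2) g(2) by blast+
    \<comment> \<open>The first gap \<open>r\<close> is entered from \<open>r - 1\<close> and the
      last gap \<open>s\<close> from \<open>s + 1\<close>. These edges are new unless they are
      already \<open>f\<close> or \<open>g\<close>, that is, unless \<open>r = 2\<close> and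
      \<open>s = n - 1\<close>. In that case vertex 3 decides: either its edge to 2 leaves
      (\<open>13\<close>), or the edge from 1 to 3 does (\<open>7\<close>).\<close>
    obtain k where k: "k \<in> ?D" "k \<noteq> 5" "k \<noteq> 4 * n + 2" "k \<noteq> f" "k \<noteq> g"
    proof -
      consider (a) "r \<noteq> 2" | (b) "r = 2" "s \<noteq> n - 1" | (c) "r = 2" "s = n - 1" by blast
      then show ?thesis
      proof cases
        case a
        have "4 * (r - 1) + 2 \<in> ?D" using rW by (intro D2) auto
        moreover have "4 * (r - 1) + 2 \<noteq> 5" "4 * (r - 1) + 2 \<noteq> 4 * n + 2"
          "4 * (r - 1) + 2 \<noteq> f" "4 * (r - 1) + 2 \<noteq> g"
          using f' g' rW(1,2) a n(2) by presburger+
        ultimately show ?thesis by (rule that)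
      next
        case b
        have "4 * (s + 1) + 1 \<in> ?D" using sW by (intro D1) auto
        moreover have "4 * (s + 1) + 1 \<noteq> 5" "4 * (s + 1) + 1 \<noteq> 4 * n + 2"
          "4 * (s + 1) + 1 \<noteq> f" "4 * (s + 1) + 1 \<noteq> g"
          using f' g' sW(1,2) b n(2) by presburger+
        ultimately show ?thesis by (rule that)
      next
        case c
        then have fg: "f = 6" "g = 4 * n + 1" using f(2) g(2) rW(3) sW(3) by auto
        show ?thesis
        proof (cases "W 3")
          case True
          then have "13 \<in> ?D" using D1[of 3] rW(3) c by simp
          moreover have "(13::nat) \<noteq> 5" "13 \<noteq> 4 * n + 2" "13 \<noteq> f" "13 \<noteq> g"
            using n unfolding fg by presburger+
          ultimately show ?thesis by (rule that)
        next
          case False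
          then have "7 \<in> ?D" using D3[of 1] W(1) n by simp
          moreover have "(7::nat) \<noteq> 5" "7 \<noteq> 4 * n + 2" "7 \<noteq> f" "7 \<noteq> g"
            using n unfolding fg by presburger+
          ultimately show ?thesis by (rule that)
        qed
      qed
    qed
    have dist: "distinct [5, 4 * n + 2, f, g, k]"
    proof -
      have "5 \<noteq> 4 * n + 2" "5 \<noteq> f" "5 \<noteq> g" "4 * n + 2 \<noteq> f" "4 * n + 2 \<noteq> g" "f \<noteq> g"
        using f' g' n(2) by presburger+
      then show ?thesis using k(2-5) by auto
    qed
    show ?thesis by (rule five_le_card[OF fin 1 2 f(1) g(1) k(1) dist])
  qed
qed

text \<open>The antiprism has no loops. Hence a component with an internal edge has at least two
  vertices, as \<open>cut_size\<close> requires.\<close>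

lemma link_div_neq:
  assumes n: "4 \<le> n" and h: "h \<in> {4..<4 * n + 4}" "link n h \<noteq> h"
  shows "link n h div 4 \<noteq> h div 4"
proof -
  have div: "(4 * i) div 4 = i" "(4 * i + 1) div 4 = i" "(4 * i + 2) div 4 = i"
    "(4 * i + 3) div 4 = i" for i :: nat
    by simp_all
  from h(1) show ?thesis
  proof (cases rule: half_edge_cases4)
    case (1 i)
    then have "i \<noteq> 2" using h(2) link_fixed(1)[OF n 1(1,2)] by metis
    show ?thesis
    proof (cases "i = 1")
      case True
      then have "link n h = 4 * n + 3" unfolding 1(3) link_eq[OF 1(1,2)]
        by (simp only: if_True simp_thms)
      moreover have "n \<noteq> i" using n True by simp
      ultimately show ?thesis using 1(3) by (simp only: div simp_thms)
    next
      case False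
      then have "link n h = 4 * (i - 2) + 3"
        unfolding 1(3) link_eq[OF 1(1,2)] using \<open>i \<noteq> 2\<close>
          by (simp only: if_False simp_thms)
      moreover have "i - 2 \<noteq> i" using 1(1) by presburger
      ultimately show ?thesis using 1(3) by (simp only: div simp_thms)
    qed
  next
    case (2 i)
    then have "i \<noteq> 1" using h(2) link_fixed(2)[OF n 2(1,2)] by metis
    moreover from this have "i - 1 \<noteq> i" using 2 by presburger
    ultimately show ?thesis
      unfolding 2(3) link_eq[OF 2(1,2)] by (simp only: div if_False simp_thms)
  next
    case (3 i)
    then have "i \<noteq> n" using h(2) link_fixed(3)[OF n 3(1,2)] by metis
    moreover have "i + 1 \<noteq> i" by simp
    ultimately show ?thesis
      unfolding 3(3) link_eq[OF 3(1,2)] by (simp only: div if_False simp_thms)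
  next
    case (4 i)
    then have "i \<noteq> n - 1" using h(2) link_fixed(4)[OF n 4(1,2)] by metis
    moreover have "i + 2 \<noteq> i" "4 div 4 = (1::nat)" "i = n \<Longrightarrow> 1 \<noteq> i" using n by auto
    ultimately show ?thesis
      unfolding 4(3) link_eq[OF 4(1,2)]
        by (cases "i = n") (simp_all only: div if_True if_False simp_thms)
  qed
qed

lemma no_divergent_subgraph:
  assumes n: "odd n" "7 \<le> n"
    and H: "ribbon_subgraph H (punctured_antiprism n)" "internal_edges H \<noteq> {}"
    and div: "\<And>K. K \<in> components H \<Longrightarrow> divergent K"
  shows "H = punctured_antiprism n"
proof -
  let ?G = "punctured_antiprism n" and ?A = "{4..<4 * n + 4}"
  have n4: "4 \<le> n" using n by simp
  have rH: "ribbon_graph H" and half: "half_edges H = ?A" and vert: "vert_perm H = rot n 1"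
    using H(1) by (auto simp: ribbon_subgraph_def punctured_antiprism_def)
  have edge: "edge_inv H h = link n h" if "edge_inv H h \<noteq> h" for h
    using ribbon_subgraph_edge_inv[OF H(1) that] by (simp add: punctured_antiprism_def)
  obtain h where h: "h \<in> ?A" "edge_inv H h \<noteq> h"
    using H(2) unfolding internal_edges_eq[OF rH] half by blast
  have "h \<in> half_edges H" using h(1) half by simp
  then obtain C where C: "C \<in> component_sets H" "h \<in> C" by (rule component_containing)
  note closed = component_closed[OF rH C(1), unfolded half vert]
  define K where "K = restrict_graph H C"
  have "divergent K" using C(1) div by (simp add: K_def components_def)
  then have K4: "card (external_half_edges K) \<le> 4" by (rule divergent_card_external)
  have ext: "external_half_edges K = {x \<in> C. edge_inv H x = x}"
    by (auto simp: K_def restrict_graph_def external_half_edges_def perm_restrict_def)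
  have fin: "finite (external_half_edges K)"
    unfolding ext using finite_subset[OF closed(1)] by simp
  \<comment> \<open>A component is closed under \<open>edge_inv H\<close>, so a link of the
    antiprism that leaves \<open>C\<close> must have been cut in \<open>H\<close>, which makes its
    half edge external in \<open>K\<close>.\<close>
  have "{x \<in> C. link n x = x \<or> link n x \<notin> C} \<subseteq> external_half_edges K"
    unfolding ext using edge closed(4) by fastforce
  then have small: "card {x \<in> C. link n x = x \<or> link n x \<notin> C} \<le> 4"
    using card_mono[OF fin, of "{x \<in> C. link n x = x \<or> link n x \<notin> C}"] K4 by linarith
  have "link n h \<in> C" using edge[OF h(2)] closed(4)[OF C(2)] by simp
  moreover have "link n h div 4 \<noteq> h div 4"
    using link_div_neq[OF n4 h(1)] h(2) edge[OF h(2)] by simp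
  ultimately have "5 \<le> card {x \<in> C. link n x = x \<or> link n x \<notin> C}" if "C \<noteq> ?A"
    using cut_size[OF n closed(1,3) that _ C(2)] by blast
  then have CA: "C = ?A" using small by linarith
  have "external_half_edges ?G \<subseteq> external_half_edges K"
  proof
    fix x assume "x \<in> external_half_edges ?G"
    then have "x \<in> ?A" "link n x = x"
      by (simp_all add: external_half_edges_def punctured_antiprism_def)
    moreover from this have "edge_inv H x = x" using edge[of x] by metis
    ultimately show "x \<in> external_half_edges K" unfolding ext CA by blast
  qed
  \<comment> \<open>The antiprism already has four external half edges and \<open>K\<close> has at
    most four, so cutting any further edge is impossible.\<close>
  then have eq: "external_half_edges ?G = external_half_edges K"
    using K4 card_external_punctured_antiprism[OF n4] by (intro card_seteq[OF fin]) simp_all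
  have "edge_inv H x = link n x" for x
  proof (cases "edge_inv H x = x \<and> x \<in> ?A")
    case True
    then have "x \<in> external_half_edges ?G" unfolding eq ext CA by blast
    then show ?thesis using True by (simp add: external_half_edges_def punctured_antiprism_def)
  next
    case False
    moreover have "link n x = x" if "x \<notin> ?A" using that by (simp add: link_def)
    moreover have "edge_inv H x = x" if "x \<notin> ?A"
      using rH half that by (simp add: ribbon_graph_def permutes_def)
    ultimately show ?thesis using edge by metis
  qed
  then show ?thesis
    using half vert by (simp add: punctured_antiprism_def fun_eq_iff)
qed

lemma primitive_punctured_antiprism:
  assumes "odd n" "7 \<le> n"
  shows "primitive (punctured_antiprism n)"
  using divergent_punctured_antiprism[OF assms] no_divergent_subgraph[OF assms]
  unfolding primitive_def by blast

theorem lemma7: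
  shows "infinite ({G :: nat ribbon_graph. primitive G \<and> boundary_lengths G = {#4#}} // iso_rel)"
proof
  let ?P = "{G :: nat ribbon_graph. primitive G \<and> boundary_lengths G = {#4#}}"
  assume fin: "finite (?P // iso_rel)"
  \<comment> \<open>The values \<open>2 * k + 7\<close> are the odd \<open>n\<close> from 7 on, that
    is, the antiprisms over a polygon with \<open>k + 4\<close> sides.\<close>
  define G where "G k = punctured_antiprism (2 * k + 7)" for k
  have G: "G k \<in> ?P" for k
    using primitive_punctured_antiprism[of "2 * k + 7"]
      boundary_lengths_punctured_antiprism[of "2 * k + 7"] by (simp add: G_def)
  have rib: "ribbon_graph (G k)" for k
    by (simp add: G_def ribbon_graph_punctured_antiprism)
  have "inj (\<lambda>k. iso_rel `` {G k})"
  proof (rule injI)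
    fix k l assume "iso_rel `` {G k} = iso_rel `` {G l}"
    then have "(G k, G l) \<in> iso_rel"
      using equiv_class_eq_iff[OF equiv_iso_rel] rib by blast
    \<comment> \<open>The number of half edges is an isomorphism invariant and here determines
      \<open>k\<close>.\<close>
    then have "card (half_edges (G k)) = card (half_edges (G l))"
      by (auto simp: iso_rel_def isomorphic_graphs_def intro: bij_betw_same_card)
    then show "k = l" by (simp add: G_def punctured_antiprism_def)
  qed
  moreover have "range (\<lambda>k. iso_rel `` {G k}) \<subseteq> ?P // iso_rel"
    using G by (auto intro: quotientI)
  ultimately show False
    using fin finite_subset[of "range (\<lambda>k. iso_rel `` {G k})"] finite_imageD[of _ "UNIV :: nat set"]
    by auto
qed

end
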